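(* The Banach space $\mathcal{X}_{(4)}$ (constructed in the context) is locally minimal, i.e. $\mathcal{X}_{(4)}$ is finitely represented in any of its infinite dimensional subspaces.
   Context: A Banach space $X$ is finitely represented in a Banach space $Y$ if for every finite dimensional subspace $E$ of $X$ and every $\varepsilon>0$ there is a linear embedding $T:E\to Y$ with $\|T\|\,\|T^{-1}|_{T(E)}\|\le 1+\varepsilon$. Let $m_1=2$, $m_{j+1}=m_j^5$; $n_1=4$, $n_{j+1}=15s_jn_j$, where $s_j=\log_2(m_{j+1}^3)$, $j\ge 1$. Fix a partition of $\mathbb{N}$ into two infinite sets $L_1,L_2$. For finitely supported $f,g$, $f<g$ means $\max\operatorname{supp}f<\min\operatorname{supp}g$; a block sequence is a sequence with $f_1<f_2<\dots$; $\operatorname{maxsupp}f=\max\operatorname{supp}f$. The $(\mathcal{A}_n,\theta)$-operation associates with a sequence $(f_1,\dots,f_k)$, $k\le n$, the vector $\theta(f_1+\dots+f_k)$. Let $W_4$ be the smallest subset of $c_{00}(\mathbb{N})$ such that: (1) $\pm e_n\in W_4$ for all $n$, where $(e_n)$ is the canonical basis of $c_{00}(\mathbb{N})$; (2) for any $f\in W_4$ and $g\in c_{00}(\mathbb{N})$ with $|f|=|g|$ (coordinatewise) also $g\in W_4$; (3) $W_4$ is closed under the projection on intervals of $\mathbb{N}$; (4) $W_4$ is closed under the $(\mathcal{A}_{n_{2j}},m_{2j}^{-1})$-operations on any block sequences; (5) $W_4$ is closed under the $(\mathcal{A}_{n_{2j+1}},m_{2j+1}^{-1})$-operations on $(2j+1)$-special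 sequences; (6) $W_4$ is closed under the $G$-operation, which associates with $f\in c_{00}(\mathbb{N})$ the vector $\frac12S_Ff$, for any set $F=\{k_1<\dots<k_{2q}\}\subset\mathbb{N}$ with $2q\le k_1$, where $S_Ff=\chi_{\bigcup_{p=1}^q[k_{2p-1},k_{2p})}f$. Here $w(f)=m_i$ means that $f$ is obtained by an $(\mathcal{A}_{n_i},m_i^{-1})$-operation as in (4) or (5). A sequence $f_1<f_2<\dots<f_{n_{2j+1}}$ in $W_4$ is a $(2j+1)$-special sequence if (i) for every $i=1,\dots,n_{2j+1}$, $w(f_i)=m_{2j_i}$, where $j_1\in L_1$, $j_i\in L_2$ for any $i>1$, and $n_{2j+1}<m_{2j_1}<\dots<m_{2j_{n_{2j+1}}}$; (ii) $m_{2j_{i+1}}>(\operatorname{maxsupp}f_i)\,m_{2j_i}$ for any $1\le i<n_{2j+1}$; (iii) for $1<i\le n_{2j+1}$ the sequence $(|f_1|,|f_2|,\dots,|f_{i-1}|)$ is uniquely determined by $w(f_i)$. $\mathcal{X}_{(4)}$ is the completion of $c_{00}(\mathbb{N})$ under the norm with norming set $W_4$, i.e. $\|x\|=\sup\{|f(x)|:f\in W_4\}$, where $f(x)=\sum_if_ix_i$.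
   Formalization: The recursion n_{j+1}=15 s_j n_j is replaced by n_{j+1}=(15 n_j)^{s_j}; with the printed product n_j<m_j for j≥3, so the norm is that of T[A_900,1/32], which contains l_∞^2 isometrically but has subspaces almost isometric to l_p, p≈2.04, so the claim fails. *)

theory Defs
  imports "HOL-Analysis.Analysis"
begin

section \<open>Finite representability and local minimality\<close>

definition finite_dim :: "'a::real_vector set \<Rightarrow> bool" where
  "finite_dim E \<longleftrightarrow> (\<exists>B. finite B \<and> E = span B)"

text \<open>The analogue of \<^const>\<open>onorm\<close> for a map that only matters on \<open>S\<close>; the quotient is \<open>0\<close> at the zero vector.\<close>

definition onorm_on :: "'a::real_normed_vector set \<Rightarrow> ('a \<Rightarrow> 'b::real_normed_vector) \<Rightarrow> real" where
  "onorm_on S f = (SUP x\<in>S. norm (f x) / norm x)"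

text \<open>Only the restriction of \<open>T\<close> to \<open>E\<close> enters; every linear map on \<open>E\<close> extends to a linear map on
  the whole type, so asking for \<open>linear T\<close> is no restriction on the embedding of \<open>E\<close>.\<close>

definition finitely_represented ::
  "'a::real_normed_vector set \<Rightarrow> 'b::real_normed_vector set \<Rightarrow> bool" where
  "finitely_represented X Y \<longleftrightarrow>
     (\<forall>E. subspace E \<and> E \<subseteq> X \<and> finite_dim E \<longrightarrow>
       (\<forall>\<epsilon>>0. \<exists>T. linear T \<and> inj_on T E \<and> T ` E \<subseteq> Y \<and>
          onorm_on E T * onorm_on (T ` E) (inv_into E T) \<le> 1 + \<epsilon>))"

definition locally_minimal :: "'a::real_normed_vector set \<Rightarrow> bool" where
  "locally_minimal X \<longleftrightarrow>
     (\<forall>Y. subspace Y \<and> closed Y \<and> Y \<subseteq> X \<and> \<not> finite_dim Y \<longrightarrow> finitely_represented X Y)"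


section \<open>Finitely supported vectors\<close>

text \<open>Coordinates are indexed by \<open>1, 2, 3, \<dots>\<close>; coordinate \<open>0\<close> of an element of \<open>c00\<close> vanishes.\<close>

type_synonym vec = "nat \<Rightarrow> real"

definition supp :: "vec \<Rightarrow> nat set" where
  "supp f = {n. f n \<noteq> 0}"

definition c00 :: "vec set" where
  "c00 = {f. finite (supp f) \<and> supp f \<subseteq> {1..}}"

definition unit_vec :: "nat \<Rightarrow> vec" where
  "unit_vec n = (\<lambda>i. if i = n then 1 else 0)"

definition absv :: "vec \<Rightarrow> vec" where
  "absv f = (\<lambda>i. \<bar>f i\<bar>)"

definition restr :: "nat set \<Rightarrow> vec \<Rightarrow> vec" where
  "restr A f = (\<lambda>i. if i \<in> A then f i else 0)"

definition pairing :: "vec \<Rightarrow> vec \<Rightarrow> real" where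
  "pairing f x = (\<Sum>i\<in>supp x. f i * x i)"

definition maxsupp :: "vec \<Rightarrow> nat" where
  "maxsupp f = Max (supp f)"

definition minsupp :: "vec \<Rightarrow> nat" where
  "minsupp f = Min (supp f)"

text \<open>Members of a block sequence are nonzero, so that \<open>maxsupp\<close> and \<open>minsupp\<close> are meaningful.\<close>

definition block_seq :: "vec list \<Rightarrow> bool" where
  "block_seq fs \<longleftrightarrow>
     (\<forall>f\<in>set fs. f \<in> c00 \<and> supp f \<noteq> {}) \<and> sorted_wrt (\<lambda>f g. maxsupp f < minsupp g) fs"

text \<open>\<open>op_result \<theta> fs\<close> is \<open>\<theta> (f\<^sub>1 + \<dots> + f\<^sub>k)\<close>.\<close>

definition op_result :: "real \<Rightarrow> vec list \<Rightarrow> vec" where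
  "op_result \<theta> fs = (\<lambda>i. \<theta> * (\<Sum>f\<leftarrow>fs. f i))"

text \<open>For \<open>F = {k\<^sub>1 < \<dots> < k\<^sub>2\<^sub>q}\<close> this is the union of the intervals \<open>[k\<^sub>2\<^sub>p\<^sub>-\<^sub>1, k\<^sub>2\<^sub>p)\<close>, \<open>1 \<le> p \<le> q\<close>;
  list positions start at \<open>0\<close>, so \<open>p\<close> below runs over \<open>0, \<dots>, q - 1\<close>.\<close>

definition alternate_blocks :: "nat set \<Rightarrow> nat set" where
  "alternate_blocks F =
     (let ks = sorted_list_of_set F in \<Union>p<card F div 2. {ks ! (2 * p) ..< ks ! (2 * p + 1)})"


section \<open>The parameters\<close>

text \<open>The sequences are indexed from \<open>1\<close>; the values at \<open>0\<close> are never used.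

  The recursion for \<open>n\<close> is \<open>n\<^sub>j\<^sub>+\<^sub>1 = (15 n\<^sub>j) ^ s\<^sub>j\<close>.  The source prints it as \<open>15 s\<^sub>j n\<^sub>j\<close>; this is
  treated here as a lost superscript, because \<open>s\<^sub>j = log\<^sub>2 (m\<^sub>j\<^sub>+\<^sub>1 ^ 3)\<close> is the usual exponent in this
  kind of construction and because the product would give \<open>n\<^sub>j < m\<^sub>j\<close> for all \<open>j \<ge> 3\<close> (already
  \<open>n\<^sub>3 = 1012500 < 2 ^ 25 = m\<^sub>3\<close>), so that of the operations only the one of index \<open>2\<close> would have
  any influence on the norm.\<close>

fun m_seq :: "nat \<Rightarrow> nat" where
  "m_seq 0 = 0"
| "m_seq (Suc 0) = 2"
| "m_seq (Suc (Suc j)) = m_seq (Suc j) ^ 5"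

definition s_seq :: "nat \<Rightarrow> real" where
  "s_seq j = log 2 (real (m_seq (Suc j)) ^ 3)"

fun n_seq :: "nat \<Rightarrow> real" where
  "n_seq 0 = 0"
| "n_seq (Suc 0) = 4"
| "n_seq (Suc (Suc j)) = (15 * n_seq (Suc j)) powr s_seq (Suc j)"


section \<open>The norming set\<close>

text \<open>A vector may be obtained by operations of several indices, so \<open>w(f) = m\<^sub>i\<close> is a relation
  \<open>wt i f\<close>.

  In condition (iii), ``uniquely determined by \<open>w(f\<^sub>i)\<close>'' refers to a coding fixed beforehand: a map
  \<open>dec\<close> that recovers the sequence \<open>(|f\<^sub>1|, \<dots>, |f\<^sub>i\<^sub>-\<^sub>1|)\<close> from the number \<open>w(f\<^sub>i)\<close>.  If \<open>\<sigma>\<close> is an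
  injective coding of finite sequences by elements of \<open>L2\<close>, the usual requirement
  \<open>w(f\<^sub>i) = m\<^bsub>2\<sigma>(|f\<^sub>1|, \<dots>, |f\<^sub>i\<^sub>-\<^sub>1|)\<^esub>\<close> is the case where \<open>dec\<close> inverts \<open>m\<^bsub>2\<sigma>(\<cdot>)\<^esub>\<close>.

  List positions start at \<open>0\<close>: \<open>fs ! i\<close> is \<open>f\<^sub>i\<^sub>+\<^sub>1\<close>, and \<open>js ! i\<close> is its index \<open>j\<^sub>i\<^sub>+\<^sub>1\<close>.\<close>

definition special_seq ::
  "nat set \<Rightarrow> nat set \<Rightarrow> (nat \<Rightarrow> vec list) \<Rightarrow> (vec \<Rightarrow> bool) \<Rightarrow> (nat \<Rightarrow> vec \<Rightarrow> bool)
     \<Rightarrow> nat \<Rightarrow> vec list \<Rightarrow> bool" where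
  "special_seq L1 L2 dec W wt j fs \<longleftrightarrow>
     real (length fs) = n_seq (2 * j + 1) \<and> block_seq fs \<and> (\<forall>f\<in>set fs. W f) \<and>
     (\<exists>js. length js = length fs \<and>
        (\<forall>i<length fs. wt (2 * js ! i) (fs ! i)) \<and>
        js ! 0 \<in> L1 \<and> (\<forall>i<length fs. 0 < i \<longrightarrow> js ! i \<in> L2) \<and>
        n_seq (2 * j + 1) < real (m_seq (2 * js ! 0)) \<and>
        (\<forall>i. Suc i < length fs \<longrightarrow> m_seq (2 * js ! i) < m_seq (2 * js ! Suc i)) \<and>
        (\<forall>i. Suc i < length fs \<longrightarrow>
            m_seq (2 * js ! Suc i) > maxsupp (fs ! i) * m_seq (2 * js ! i)) \<and>
        (\<forall>i<length fs. 0 < i \<longrightarrow> dec (m_seq (2 * js ! i)) = map absv (take i fs)))"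

lemma special_seq_mono [mono]:
  assumes "\<And>f. W f \<longrightarrow> W' f" and "\<And>i f. wt i f \<longrightarrow> wt' i f"
  shows "special_seq L1 L2 dec W wt j fs \<longrightarrow> special_seq L1 L2 dec W' wt' j fs"
proof
  assume "special_seq L1 L2 dec W wt j fs"
  then show "special_seq L1 L2 dec W' wt' j fs"
    unfolding special_seq_def using assms by (elim conjE exE) (intro conjI exI, auto)
qed

inductive
  W4 :: "nat set \<Rightarrow> nat set \<Rightarrow> (nat \<Rightarrow> vec list) \<Rightarrow> vec \<Rightarrow> bool" and
  has_weight :: "nat set \<Rightarrow> nat set \<Rightarrow> (nat \<Rightarrow> vec list) \<Rightarrow> nat \<Rightarrow> vec \<Rightarrow> bool"
  for L1 L2 :: "nat set" and dec :: "nat \<Rightarrow> vec list"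
where
  unit: "n \<ge> 1 \<Longrightarrow> W4 L1 L2 dec (unit_vec n)"
| neg_unit: "n \<ge> 1 \<Longrightarrow> W4 L1 L2 dec (\<lambda>i. - unit_vec n i)"
| signs: "W4 L1 L2 dec f \<Longrightarrow> g \<in> c00 \<Longrightarrow> absv f = absv g \<Longrightarrow> W4 L1 L2 dec g"
| interval: "W4 L1 L2 dec f \<Longrightarrow> W4 L1 L2 dec (restr {a..b} f)"
| weighted: "has_weight L1 L2 dec i f \<Longrightarrow> W4 L1 L2 dec f"
| G_operation: "W4 L1 L2 dec f \<Longrightarrow> finite F \<Longrightarrow> F \<noteq> {} \<Longrightarrow> card F = 2 * q \<Longrightarrow> 2 * q \<le> Min F \<Longrightarrow>
    W4 L1 L2 dec (\<lambda>i. 1 / 2 * restr (alternate_blocks F) f i)"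
| even_operation: "j \<ge> 1 \<Longrightarrow> fs \<noteq> [] \<Longrightarrow> real (length fs) \<le> n_seq (2 * j) \<Longrightarrow> block_seq fs \<Longrightarrow>
    (\<forall>f\<in>set fs. W4 L1 L2 dec f) \<Longrightarrow>
    has_weight L1 L2 dec (2 * j) (op_result (1 / real (m_seq (2 * j))) fs)"
| odd_operation: "j \<ge> 1 \<Longrightarrow> special_seq L1 L2 dec (W4 L1 L2 dec) (has_weight L1 L2 dec) j fs \<Longrightarrow>
    has_weight L1 L2 dec (2 * j + 1) (op_result (1 / real (m_seq (2 * j + 1))) fs)"

definition X4_norm :: "nat set \<Rightarrow> nat set \<Rightarrow> (nat \<Rightarrow> vec list) \<Rightarrow> vec \<Rightarrow> real" where
  "X4_norm L1 L2 dec x = (SUP f\<in>{f. W4 L1 L2 dec f}. \<bar>pairing f x\<bar>)"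


section \<open>The completion\<close>

text \<open>A Banach space is a completion of \<open>c00\<close> under the norm \<open>N\<close>, with canonical map \<open>\<iota>\<close>, if \<open>\<iota>\<close>
  is a linear isometry with dense range.  This determines the Banach space up to isometric
  isomorphism.\<close>

definition is_completion_of_c00 :: "(vec \<Rightarrow> real) \<Rightarrow> (vec \<Rightarrow> 'a::banach) \<Rightarrow> bool" where
  "is_completion_of_c00 N \<iota> \<longleftrightarrow>
     (\<forall>x\<in>c00. \<forall>y\<in>c00. \<forall>a b. \<iota> (\<lambda>i. a * x i + b * y i) = a *\<^sub>R \<iota> x + b *\<^sub>R \<iota> y) \<and>
     (\<forall>x\<in>c00. norm (\<iota> x) = N x) \<and>
     closure (\<iota> ` c00) = UNIV"

end

theory Submission
  imports Defs
begin

text \<open>The idea: every infinite dimensional subspace \<open>Y\<close> contains almost isometric copies of all the spaces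
  \<open>l\<^sub>\<infinity>\<^sup>n\<close>, and every finite dimensional space embeds almost isometrically into one of these.

  A gliding hump replaces \<open>Y\<close> by the span of a block sequence \<open>u\<close>. In it there are averages of \<open>l\<^sub>1\<close>-type
  and hence a rapidly increasing sequence \<open>z\<close> of such averages. For given \<open>l\<close>, let \<open>y\<^sub>k\<close>
  (\<open>k < l\<close>) be the sum of \<open>n\<^sub>j\<close> members of \<open>z\<close> times \<open>m\<^sub>j / n\<^sub>j\<close>, where \<open>j = 2k + 2\<close>. One even
  operation gives \<open>norm y\<^sub>k \<ge> 1\<close>. The index sets of the \<open>y\<^sub>k\<close> are chosen disjoint, but interlaced and
  each equidistributed: then a functional that is large on one \<open>y\<^sub>k\<close> sees on each piece only a
  proportional part of all the others, and \<open>norm (y\<^sub>0 + \<dots> + y\<^bsub>l-1\<^esub>)\<close> is bounded independently of \<open>l\<close>.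
  Upper bounds only use that each weighted functional is \<open>1 / m\<^sub>i\<close> times a sum of at most \<open>n\<^sub>i\<close>
  successive functionals, so the special sequences and the coding play no role, and the \<open>G\<close>-operation
  only decreases moduli. Since the basis is unconditional, James' submultiplicativity argument turns
  the bound for all \<open>l = n ^ k\<close> into \<open>n\<close> disjointly supported vectors of norm at least \<open>1\<close> whose
  sum has norm at most \<open>1 + \<delta>\<close>.\<close>

subsection \<open>Parameters and functionals\<close>

lemma m_seq_eq: "m_seq (Suc j) = 2 ^ 5 ^ j"
  by (induction j) (simp_all flip: power_mult add: mult.commute)

lemma m_seq_ge_2power: "i \<ge> 1 \<Longrightarrow> 2 ^ i \<le> m_seq i"
proof (induction i rule: nat_induct_at_least)
  case (Suc i)
  then obtain j where j: "i = Suc j" by (cases i) auto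
  have "2 ^ Suc i = 2 * (2::nat) ^ i" by simp
  also have "\<dots> \<le> m_seq i ^ 4 * m_seq i"
    using Suc.IH power_increasing[of 1 4 "m_seq i"] power_increasing[of 1 i "2::nat"] Suc.hyps
    by (intro mult_mono) auto
  finally show ?case by (simp add: j eval_nat_numeral ac_simps)
qed simp

lemma m_seq_mono: "1 \<le> i \<Longrightarrow> i \<le> j \<Longrightarrow> m_seq i \<le> m_seq j"
  by (cases i; cases j) (auto simp: m_seq_eq intro!: power_increasing)

lemma m_seq_pos: "1 \<le> i \<Longrightarrow> 0 < m_seq i"
  by (cases i) (auto simp: m_seq_eq)

lemma m_seq_ge_32: "2 \<le> i \<Longrightarrow> 32 \<le> m_seq i"
  using m_seq_mono[of 2 i] m_seq_eq[of 1] by (simp add: numeral_2_eq_2[symmetric])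

lemma m_seq_unbounded: "\<exists>i\<ge>2. real (m_seq i) \<ge> B"
proof -
  obtain n where n: "B < 2 ^ n" using real_arch_pow[of 2 B] by auto
  have "real (2 ^ (n + 2)) \<le> real (m_seq (n + 2))"
    using m_seq_ge_2power[of "n + 2"] by linarith
  moreover have "(2::real) ^ n \<le> 2 ^ (n + 2)" by (rule power_increasing) auto
  ultimately have "B \<le> real (m_seq (n + 2))" using n unfolding of_nat_power of_nat_numeral by linarith
  then show ?thesis by (intro exI[of _ "n + 2"]) auto
qed

text \<open>Each term is at least twice its predecessor, so the last one dominates as in a geometric
  series. This controls the total error term in \<open>sum_\<Phi>_le\<close>.\<close>

lemma sum_m_seq_le: "1 \<le> i \<Longrightarrow> (\<Sum>j\<in>{1..i}. real (m_seq j)) \<le> 2 * real (m_seq i)"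
proof (induction i rule: nat_induct_at_least)
  case (Suc i)
  then obtain j where j: "i = Suc j" by (cases i) auto
  have "2 * m_seq i \<le> m_seq i ^ 4 * m_seq i"
    using power_increasing[of 1 4 "m_seq i"] m_seq_ge_2power[of i] power_increasing[of 1 i "2::nat"] Suc.hyps
    by (intro mult_mono) auto
  then have "2 * m_seq i \<le> m_seq (Suc i)" by (simp add: j eval_nat_numeral ac_simps)
  then have "2 * real (m_seq i) \<le> real (m_seq (Suc i))" by linarith
  with Suc.IH show ?case by simp
qed simp

text \<open>As \<open>m_seq\<close> consists of powers of two, the logarithm is a natural number,
  and the \<open>powr\<close> in the recursion of \<open>n_seq\<close> turns into an ordinary
  power.\<close>

lemma s_seq_eq: "s_seq j = real (3 * 5 ^ j)"
proof -
  have "s_seq j = log 2 ((2 ^ 5 ^ j) ^ 3)" by (simp add: s_seq_def m_seq_eq)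
  also have "\<dots> = log 2 (2 ^ (3 * 5 ^ j))" by (simp flip: power_mult add: mult.commute)
  also have "\<dots> = real (3 * 5 ^ j)" by (subst log_nat_power) auto
  finally show ?thesis .
qed

lemma n_seq_Suc_pos:
  assumes "1 \<le> j" "0 < n_seq j"
  shows "n_seq (Suc j) = (15 * n_seq j) ^ (3 * 5 ^ j)"
proof -
  obtain k where "j = Suc k" using assms(1) by (cases j) auto
  then show ?thesis using assms(2) by (simp only: n_seq.simps s_seq_eq powr_realpow mult_pos_pos)
qed

lemma n_seq_ge_4: "1 \<le> j \<Longrightarrow> 4 \<le> n_seq j"
proof (induction j rule: nat_induct_at_least)
  case (Suc j)
  then have "4 \<le> (15 * n_seq j) ^ 1" by simp
  also have "\<dots> \<le> (15 * n_seq j) ^ (3 * 5 ^ j)"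
    using Suc.IH by (intro power_increasing) auto
  finally show ?case using Suc by (simp add: n_seq_Suc_pos)
qed auto

lemma n_seq_Suc: "1 \<le> j \<Longrightarrow> n_seq (Suc j) = (15 * n_seq j) ^ (3 * 5 ^ j)"
  using n_seq_ge_4[of j] by (intro n_seq_Suc_pos) auto

lemma n_seq_Suc_ge: "1 \<le> j \<Longrightarrow> 15 * n_seq j \<le> n_seq (Suc j)"
  using n_seq_ge_4[of j] power_increasing[of 1 "3 * 5 ^ j" "15 * n_seq j"] by (simp add: n_seq_Suc)

lemma n_seq_mono: "1 \<le> i \<Longrightarrow> i \<le> j \<Longrightarrow> n_seq i \<le> n_seq j"
proof (induction j)
  case (Suc j)
  show ?case
  proof (cases "i = Suc j")
    case False
    then have "n_seq i \<le> n_seq j" "1 \<le> j" using Suc by auto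
    then show ?thesis using n_seq_Suc_ge[of j] n_seq_ge_4[of j] by linarith
  qed simp
qed simp

text \<open>An odd index is reached so that the next index is even: \<open>exists_l1_tuple\<close>
  exploits the jump from \<open>n_seq (2 * j - 1)\<close> to \<open>n_seq (2 * j)\<close> and
  applies an even operation there.\<close>

lemma n_seq_unbounded: "\<exists>j\<ge>1. B \<le> n_seq (2 * j - 1)"
proof -
  have *: "real i \<le> n_seq i" for i
  proof (induction i)
    case (Suc i)
    then show ?case using n_seq_Suc_ge[of i] n_seq_ge_4[of i] by (cases "i = 0") auto
  qed simp
  obtain k :: nat where "B \<le> real k" using real_arch_simple by blast
  then have "B \<le> n_seq (2 * (k + 1) - 1)" using *[of "2 * (k + 1) - 1"] by simp
  then show ?thesis by (intro exI[of _ "k + 1"]) auto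
qed

text \<open>The values of \<open>n_seq\<close> are natural numbers; this version supplies index sets
  and cardinalities.\<close>

fun n_nat :: "nat \<Rightarrow> nat" where
  "n_nat 0 = 0"
| "n_nat (Suc 0) = 4"
| "n_nat (Suc (Suc j)) = (15 * n_nat (Suc j)) ^ (3 * 5 ^ Suc j)"

lemma real_n_nat: "real (n_nat j) = n_seq j"
proof (induction j rule: n_nat.induct)
  case (3 j)
  then show ?case by (simp only: n_nat.simps n_seq_Suc le_add1 plus_1_eq_Suc) simp
qed auto

section \<open>Block sequences and elementary properties of the norming set\<close>

lemma supp_unit_vec: "supp (unit_vec n) = {n}"
  by (auto simp: supp_def unit_vec_def)

lemma block_seq_disjoint:
  assumes "block_seq fs" "s < t" "t < length fs" "i \<in> supp (fs ! s)" "j \<in> supp (fs ! t)"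
  shows "i < j"
proof -
  have "maxsupp (fs ! s) < minsupp (fs ! t)"
    using assms by (auto simp: block_seq_def sorted_wrt_iff_nth_less)
  moreover have "finite (supp (fs ! s))" "finite (supp (fs ! t))"
    using assms by (auto simp: block_seq_def c00_def)
  then have "i \<le> maxsupp (fs ! s)" "minsupp (fs ! t) \<le> j"
    using assms(4,5) unfolding maxsupp_def minsupp_def by (blast intro: Max_ge Min_le)+
  ultimately show ?thesis by linarith
qed

lemma op_result_nth: "op_result \<theta> fs i = \<theta> * (\<Sum>s<length fs. (fs ! s) i)"
  by (simp add: op_result_def sum_list_sum_nth atLeast0LessThan)

lemma op_result_at:
  assumes "block_seq fs" "s < length fs" "i \<in> supp (fs ! s)"
  shows "op_result \<theta> fs i = \<theta> * (fs ! s) i"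
proof -
  have "(fs ! t) i = 0" if "t < length fs" "t \<noteq> s" for t
  proof (rule ccontr)
    assume "(fs ! t) i \<noteq> 0"
    then have "i \<in> supp (fs ! t)" by (simp add: supp_def)
    then show False
      using block_seq_disjoint[OF assms(1), of s t i i] block_seq_disjoint[OF assms(1), of t s i i] that assms
      by linarith
  qed
  then have "(\<Sum>t<length fs. (fs ! t) i) = (fs ! s) i"
    using assms(2) by (subst sum.remove[of _ s]) auto
  then show ?thesis by (simp add: op_result_nth)
qed

lemma supp_op_result: "supp (op_result \<theta> fs) \<subseteq> (\<Union>s<length fs. supp (fs ! s))"
  by (auto simp: supp_def op_result_nth elim!: sum.not_neutral_contains_not_neutral)

lemma op_result_c00:
  assumes "block_seq fs"
  shows "op_result \<theta> fs \<in> c00"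
proof -
  have "finite (supp (fs ! s))" "supp (fs ! s) \<subseteq> {1..}" if "s < length fs" for s
    using assms that by (auto simp: block_seq_def c00_def)
  then have "finite (\<Union>s<length fs. supp (fs ! s))" "(\<Union>s<length fs. supp (fs ! s)) \<subseteq> {1..}"
    by blast+
  then show ?thesis
    using supp_op_result[of \<theta> fs] finite_subset[OF supp_op_result] unfolding c00_def by blast
qed

text \<open>At most one member of a block sequence is nonzero at a given coordinate, so the bound
  does not depend on the length of the sequence.\<close>

lemma op_result_bounded:
  assumes "block_seq fs" "\<forall>f\<in>set fs. \<bar>f i\<bar> \<le> 1" "0 \<le> \<theta>"
  shows "\<bar>op_result \<theta> fs i\<bar> \<le> \<theta>"
proof (cases "\<exists>s<length fs. i \<in> supp (fs ! s)")
  case True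
  then obtain s where s: "s < length fs" "i \<in> supp (fs ! s)" by blast
  then have "\<bar>(fs ! s) i\<bar> \<le> 1" using assms(2) by auto
  then show ?thesis using s assms(3) by (simp add: op_result_at[OF assms(1)] abs_mult mult_left_le)
next
  case False
  then have "i \<notin> supp (op_result \<theta> fs)" using supp_op_result[of \<theta> fs] by blast
  then show ?thesis using assms(3) by (simp add: supp_def)
qed

lemma inv_m_seq_le_1: "2 \<le> i \<Longrightarrow> 1 / real (m_seq i) \<le> 1"
  using m_seq_ge_32[of i] by simp

lemma W4_bounded:
  assumes "W4 L1 L2 dec f"
  shows "f \<in> c00 \<and> (\<forall>i. \<bar>f i\<bar> \<le> 1)"
proof -
  have op: "op_result (1 / real (m_seq i)) fs \<in> c00 \<and> (\<forall>n. \<bar>op_result (1 / real (m_seq i)) fs n\<bar> \<le> 1)"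
    if "block_seq fs" "2 \<le> i" "\<forall>f\<in>set fs. W4 L1 L2 dec f \<and> f \<in> c00 \<and> (\<forall>i. \<bar>f i\<bar> \<le> 1)" for fs i
  proof -
    have "\<bar>op_result (1 / real (m_seq i)) fs n\<bar> \<le> 1 / real (m_seq i)" for n
      using that by (intro op_result_bounded) auto
    then show ?thesis
      using op_result_c00[OF that(1)] inv_m_seq_le_1[OF that(2)] order_trans by blast
  qed
  have "(W4 L1 L2 dec f \<longrightarrow> f \<in> c00 \<and> (\<forall>i. \<bar>f i\<bar> \<le> 1)) \<and>
    (has_weight L1 L2 dec i g \<longrightarrow> g \<in> c00 \<and> (\<forall>i. \<bar>g i\<bar> \<le> 1))" for i g
  proof (induction rule: W4_has_weight.induct)
    case (signs f g)
    then show ?case by (auto simp: absv_def fun_eq_iff) 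
  next
    case (interval f a b)
    then show ?case by (auto simp: restr_def c00_def supp_def elim: finite_subset[rotated])
  next
    case (G_operation f F q)
    then have f: "f \<in> c00" "\<bar>f i\<bar> \<le> 1" for i by blast+
    have "supp (\<lambda>i. 1 / 2 * restr (alternate_blocks F) f i) \<subseteq> supp f"
      by (auto simp: supp_def restr_def)
    with f(1) have "(\<lambda>i. 1 / 2 * restr (alternate_blocks F) f i) \<in> c00"
      by (auto simp: c00_def intro: finite_subset)
    moreover have "\<bar>1 / 2 * restr (alternate_blocks F) f i\<bar> \<le> 1" for i
      using f(2)[of i] by (simp add: restr_def)
    ultimately show ?case by blast
  next
    case (even_operation j fs)
    then show ?case by (intro op) auto
  next
    case (odd_operation j fs)
    then show ?case by (intro op) (auto simp: special_seq_def)
  qed (auto simp: supp_def c00_def unit_vec_def)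
  then show ?thesis using assms by blast
qed

text \<open>Upper estimates only see the moduli of the functionals. Up to passing to a smaller modulus,
  each of the operations other than the weighted ones is trivial, and being a special sequence is forgotten.\<close>

lemma W4_modulus_induct [consumes 1, case_names unit mono op]:
  assumes W: "W4 L1 L2 dec f"
    and unit: "\<And>n. 1 \<le> n \<Longrightarrow> P (unit_vec n)"
    and mono: "\<And>f g. P f \<Longrightarrow> f \<in> c00 \<Longrightarrow> g \<in> c00 \<Longrightarrow> (\<And>i. \<bar>g i\<bar> \<le> \<bar>f i\<bar>) \<Longrightarrow> P g"
    and op: "\<And>i fs. 2 \<le> i \<Longrightarrow> block_seq fs \<Longrightarrow> real (length fs) \<le> n_seq i \<Longrightarrow>
      W4 L1 L2 dec (op_result (1 / real (m_seq i)) fs) \<Longrightarrow> (\<And>f. f \<in> set fs \<Longrightarrow> W4 L1 L2 dec f \<and> P f) \<Longrightarrow> P (op_result (1 / real (m_seq i)) fs)"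
  shows "P f"
proof -
  have "(W4 L1 L2 dec f \<longrightarrow> W4 L1 L2 dec f \<and> P f) \<and> (has_weight L1 L2 dec i g \<longrightarrow> P g)" for i g
  proof (induction rule: W4_has_weight.induct)
    case (unit n)
    then show ?case using assms(2) W4_has_weight.unit by blast
  next
    case (neg_unit n)
    then show ?case
      by (intro conjI W4_has_weight.neg_unit mono[OF assms(2)[OF neg_unit]])
        (auto simp: c00_def supp_def unit_vec_def)
  next
    case (signs f g)
    then have "W4 L1 L2 dec f" by blast
    then show ?case using signs W4_bounded[of L1 L2 dec f]
      by (intro conjI W4_has_weight.signs[of L1 L2 dec f g] mono[of f g]) (auto simp: absv_def fun_eq_iff)
  next
    case (interval f a b)
    then have W: "W4 L1 L2 dec f" by blast
    note W = W W4_has_weight.interval[OF W, of a b]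
    have "P (restr {a..b} f)"
      using interval W4_bounded[OF W(1)] W4_bounded[OF W(2)] by - (rule mono[of f], auto simp: restr_def)
    with W show ?case by blast
  next
    case (weighted i f)
    then show ?case using W4_has_weight.weighted[of L1 L2 dec i f] by blast
  next
    case (G_operation f F q)
    then have W: "W4 L1 L2 dec f" by blast
    note W = W W4_has_weight.G_operation[OF W G_operation(3-6)]
    have "P (\<lambda>i. 1 / 2 * restr (alternate_blocks F) f i)"
      using G_operation W4_bounded[OF W(1)] W4_bounded[OF W(2)] by - (rule mono[of f], auto simp: restr_def)
    with W show ?case by blast
  next
    case (even_operation j fs)
    then have "has_weight L1 L2 dec (2 * j) (op_result (1 / real (m_seq (2 * j))) fs)"
      by (intro W4_has_weight.even_operation) auto
    then show ?case using even_operation W4_has_weight.weighted by (intro op) auto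
  next
    case (odd_operation j fs)
    \<comment> \<open>The induction hypotheses sit inside the predicates passed to
      \<open>special_seq\<close>; monotonicity strips them off, so that the introduction rule
      applies again.\<close>
    then have "special_seq L1 L2 dec (W4 L1 L2 dec) (has_weight L1 L2 dec) j fs"
      using special_seq_mono[of "\<lambda>f. W4 L1 L2 dec f \<and> W4 L1 L2 dec f \<and> P f"
          "W4 L1 L2 dec" "\<lambda>i f. has_weight L1 L2 dec i f \<and> P f" "has_weight L1 L2 dec" L1 L2 dec j fs]
      by blast
    then have "has_weight L1 L2 dec (2 * j + 1) (op_result (1 / real (m_seq (2 * j + 1))) fs)"
      by (intro W4_has_weight.odd_operation odd_operation(1))
    then have "W4 L1 L2 dec (op_result (1 / real (m_seq (2 * j + 1))) fs)" by (rule W4_has_weight.weighted)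
    then show ?case using odd_operation by (intro op) (auto simp: special_seq_def)
  qed
  then show ?thesis using W by blast
qed

declare m_seq.simps(3) [simp del] n_seq.simps(3) [simp del] n_nat.simps(3) [simp del]

subsection \<open>Coordinates, moduli and unconditionality\<close>

locale X4_completion =
  fixes L1 L2 :: "nat set"
    and dec :: "nat \<Rightarrow> vec list"
    and \<iota> :: "vec \<Rightarrow> 'a::banach"
  assumes completion: "is_completion_of_c00 (X4_norm L1 L2 dec) \<iota>"
begin

abbreviation W :: "vec \<Rightarrow> bool" where "W \<equiv> W4 L1 L2 dec"

lemma iota_lincomb:
  "x \<in> c00 \<Longrightarrow> y \<in> c00 \<Longrightarrow> \<iota> (\<lambda>i. a * x i + b * y i) = a *\<^sub>R \<iota> x + b *\<^sub>R \<iota> y"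
  using completion by (simp add: is_completion_of_c00_def)

lemma norm_iota: "x \<in> c00 \<Longrightarrow> norm (\<iota> x) = X4_norm L1 L2 dec x"
  using completion by (simp add: is_completion_of_c00_def)

lemma c00_lincomb:
  assumes "x \<in> c00" "y \<in> c00"
  shows "(\<lambda>i. a * x i + b * y i) \<in> c00"
proof -
  have "supp (\<lambda>i. a * x i + b * y i) \<subseteq> supp x \<union> supp y" by (auto simp: supp_def)
  then show ?thesis using assms finite_subset[of _ "supp x \<union> supp y"] unfolding c00_def by blast
qed

lemma zero_c00: "(\<lambda>i. 0) \<in> c00"
  by (simp add: c00_def supp_def)

lemma iota_zero: "\<iota> (\<lambda>i. 0) = 0"
  using iota_lincomb[OF zero_c00 zero_c00, of 0 0] by simp

lemma iota_approx:
  assumes "0 < e"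
  obtains x where "x \<in> c00" "norm (\<iota> x - w) < e"
proof -
  have "w \<in> closure (\<iota> ` c00)" using completion by (simp add: is_completion_of_c00_def)
  with assms that show thesis by (auto simp: closure_approachable dist_norm)
qed

lemma pairing_abs_le:
  assumes "W f"
  shows "\<bar>pairing f x\<bar> \<le> (\<Sum>i\<in>supp x. \<bar>x i\<bar>)"
  unfolding pairing_def
  by (rule order_trans[OF sum_abs], rule sum_mono)
    (use W4_bounded[OF assms] in \<open>auto simp: abs_mult intro: mult_left_le_one_le\<close>)

lemma bdd_above_pairing: "bdd_above ((\<lambda>f. \<bar>pairing f x\<bar>) ` {f. W f})"
  by (rule bdd_aboveI2[where M = "\<Sum>i\<in>supp x. \<bar>x i\<bar>"]) (use pairing_abs_le in blast)

lemma pairing_le_norm: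
  assumes "W f" "x \<in> c00"
  shows "\<bar>pairing f x\<bar> \<le> norm (\<iota> x)"
  unfolding norm_iota[OF assms(2)] X4_norm_def
  by (rule cSUP_upper[OF _ bdd_above_pairing]) (use assms in simp)

lemma coordinate_le_norm:
  assumes "x \<in> c00" "1 \<le> n"
  shows "\<bar>x n\<bar> \<le> norm (\<iota> x)"
proof -
  have "pairing (unit_vec n) x = (\<Sum>i\<in>supp x. if i = n then x i else 0)"
    unfolding pairing_def by (rule sum.cong) (auto simp: unit_vec_def)
  also have "\<dots> = x n" using assms(1) by (simp add: c00_def supp_def)
  finally show ?thesis using pairing_le_norm[OF W4_has_weight.unit[OF assms(2)] assms(1)] by simp
qed

lemma iota_diff: "x \<in> c00 \<Longrightarrow> y \<in> c00 \<Longrightarrow> \<iota> (\<lambda>i. x i - y i) = \<iota> x - \<iota> y"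
  using iota_lincomb[of x y 1 "-1"] by simp

lemma c00_diff: "x \<in> c00 \<Longrightarrow> y \<in> c00 \<Longrightarrow> (\<lambda>i. x i - y i) \<in> c00"
  using c00_lincomb[of x y 1 "-1"] by simp

lemma c00_zero_coordinate: "x \<in> c00 \<Longrightarrow> x 0 = 0"
  by (auto simp: c00_def supp_def)

lemma coordinate_diff_le:
  assumes "x \<in> c00" "y \<in> c00"
  shows "\<bar>x n - y n\<bar> \<le> norm (\<iota> x - \<iota> y)"
  using coordinate_le_norm[OF c00_diff[OF assms], of n] c00_zero_coordinate[OF assms(1)]
    c00_zero_coordinate[OF assms(2)] assms
  by (cases "n = 0") (auto simp: iota_diff)

text \<open>The 1-Lipschitz extension of the coordinate functional from \<open>c00\<close> to the completion.\<close>

definition coord :: "nat \<Rightarrow> 'a \<Rightarrow> real" where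
  "coord n w = (SUP x\<in>c00. x n - norm (\<iota> x - w))"

lemma coord_approx:
  assumes "x \<in> c00"
  shows "\<bar>x n - coord n w\<bar> \<le> norm (\<iota> x - w)"
proof -
  have *: "y n - norm (\<iota> y - w) \<le> x n + norm (\<iota> x - w)" if "x \<in> c00" "y \<in> c00" for x y
    using coordinate_diff_le[OF that, of n] norm_triangle_ineq4[of "\<iota> x - w" "\<iota> y - w"] by simp
  have "x n - norm (\<iota> x - w) \<le> coord n w"
    unfolding coord_def
    by (rule cSUP_upper[OF assms], rule bdd_aboveI2[where M = "x n + norm (\<iota> x - w)"]) (use * assms in blast)
  moreover have "coord n w \<le> x n + norm (\<iota> x - w)"
    unfolding coord_def using * assms by (intro cSUP_least) auto
  ultimately show ?thesis by linarith
qed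

lemma coord_iota: "x \<in> c00 \<Longrightarrow> coord n (\<iota> x) = x n"
  using coord_approx[of x n "\<iota> x"] by simp

lemma abs_coord_le: "\<bar>coord n w\<bar> \<le> norm w"
  using coord_approx[OF zero_c00, of n w] by (simp add: iota_zero)

lemma coord_0: "coord 0 w = 0"
proof -
  have "\<bar>coord 0 w\<bar> \<le> 0 + e" if "0 < e" for e
    using iota_approx[OF that, of w] coord_approx[of _ 0 w] c00_zero_coordinate by (smt (verit))
  then show ?thesis using field_le_epsilon[of "\<bar>coord 0 w\<bar>" 0] by auto
qed

lemma coord_lincomb: "coord n (a *\<^sub>R v + b *\<^sub>R w) = a * coord n v + b * coord n w"
proof -
  let ?d = "\<bar>coord n (a *\<^sub>R v + b *\<^sub>R w) - (a * coord n v + b * coord n w)\<bar>"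
  have "?d \<le> 0 + e" if "0 < e" for e
  proof -
    \<comment> \<open>The approximation error enters twice, once for the vectors and once for their
      coordinates, with weights \<open>\<bar>a\<bar>\<close> and
      \<open>\<bar>b\<bar>\<close>.\<close>
    define e' where "e' = e / (2 * (\<bar>a\<bar> + \<bar>b\<bar> + 1))"
    have "0 < e'" using that by (simp add: e'_def)
    then obtain x y where x: "x \<in> c00" "norm (\<iota> x - v) < e'" and y: "y \<in> c00" "norm (\<iota> y - w) < e'"
      using iota_approx by metis
    let ?z = "\<lambda>i. a * x i + b * y i"
    have "norm (\<iota> ?z - (a *\<^sub>R v + b *\<^sub>R w)) = norm (a *\<^sub>R (\<iota> x - v) + b *\<^sub>R (\<iota> y - w))"
      by (simp add: iota_lincomb x y algebra_simps)
    also have "\<dots> \<le> \<bar>a\<bar> * norm (\<iota> x - v) + \<bar>b\<bar> * norm (\<iota> y - w)"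
      by (rule order_trans[OF norm_triangle_ineq]) simp
    finally have "\<bar>?z n - coord n (a *\<^sub>R v + b *\<^sub>R w)\<bar> \<le> \<bar>a\<bar> * norm (\<iota> x - v) + \<bar>b\<bar> * norm (\<iota> y - w)"
      using coord_approx[OF c00_lincomb[OF x(1) y(1), of a b], of n] by (meson order_trans)
    moreover have "\<bar>a * x n - a * coord n v\<bar> \<le> \<bar>a\<bar> * norm (\<iota> x - v)"
      using coord_approx[OF x(1), of n v] by (simp flip: right_diff_distrib add: abs_mult mult_left_mono)
    moreover have "\<bar>b * y n - b * coord n w\<bar> \<le> \<bar>b\<bar> * norm (\<iota> y - w)"
      using coord_approx[OF y(1), of n w] by (simp flip: right_diff_distrib add: abs_mult mult_left_mono)
    moreover have "\<bar>c - (p' + q')\<bar> \<le> 2 * (A + B)"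
      if "\<bar>p + q - c\<bar> \<le> A + B" "\<bar>p - p'\<bar> \<le> A" "\<bar>q - q'\<bar> \<le> B" for p q p' q' c A B :: real
      using that unfolding abs_le_iff by argo
    ultimately have "?d \<le> 2 * (\<bar>a\<bar> * norm (\<iota> x - v) + \<bar>b\<bar> * norm (\<iota> y - w))" by blast
    also have "\<dots> \<le> 2 * (\<bar>a\<bar> * e' + \<bar>b\<bar> * e')"
      using x(2) y(2) by (intro mult_left_mono add_mono) auto
    also have "\<dots> \<le> 2 * (\<bar>a\<bar> + \<bar>b\<bar> + 1) * e'" using \<open>0 < e'\<close> by (simp add: algebra_simps)
    also have "\<dots> = e" by (simp add: e'_def add_pos_nonneg divide_simps)
    finally show ?thesis by simp
  qed
  then show ?thesis using field_le_epsilon[of ?d 0] by auto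
qed

lemma bounded_linear_coord: "bounded_linear (coord n)"
  using coord_lincomb[of n 1 _ 1] coord_lincomb[of n _ _ 0] abs_coord_le
  by (intro bounded_linear_intro[where K = 1]) auto

sublocale coord: bounded_linear "coord n" for n
  by (rule bounded_linear_coord)

section \<open>Norming functionals on the completion and unconditionality\<close>

text \<open>The continuous extension of \<open>pairing f\<close>. The sum runs over the support of
  \<open>f\<close>, because an element of the completion may have infinitely many nonzero
  coordinates.\<close>

definition pr :: "vec \<Rightarrow> 'a \<Rightarrow> real" where
  "pr f w = (\<Sum>n\<in>supp f. f n * coord n w)"

lemma bounded_linear_pr: "bounded_linear (pr f)"
  unfolding pr_def
  by (intro bounded_linear_sum bounded_linear_const_mult bounded_linear_coord)

sublocale pr: bounded_linear "pr f" for f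
  by (rule bounded_linear_pr)

lemma pr_iota:
  assumes "f \<in> c00" "x \<in> c00"
  shows "pr f (\<iota> x) = pairing f x"
proof -
  have "pr f (\<iota> x) = (\<Sum>n\<in>supp f. f n * x n)" by (simp add: pr_def coord_iota assms)
  also have "\<dots> = (\<Sum>n\<in>supp f \<union> supp x. f n * x n)"
    using assms by (intro sum.mono_neutral_left) (auto simp: c00_def supp_def)
  also have "\<dots> = pairing f x" unfolding pairing_def
    using assms by (intro sum.mono_neutral_right) (auto simp: c00_def supp_def)
  finally show ?thesis .
qed

lemma abs_pr_le_norm:
  assumes "W f"
  shows "\<bar>pr f w\<bar> \<le> norm w"
proof (rule field_le_epsilon)
  fix e :: real assume "0 < e"
  obtain K where K: "0 < K" "\<And>v. \<bar>pr f v\<bar> \<le> norm v * K"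
    using pr.pos_bounded[of f] by auto
  have "0 < e / (K + 1)" using \<open>0 < e\<close> K by simp
  then obtain x where x: "x \<in> c00" "norm (\<iota> x - w) < e / (K + 1)" using iota_approx by blast
  have "pr f w = pr f (\<iota> x) - pr f (\<iota> x - w)" by (simp add: pr.diff)
  then have "\<bar>pr f w\<bar> \<le> \<bar>pr f (\<iota> x)\<bar> + \<bar>pr f (\<iota> x - w)\<bar>" by linarith
  also have "\<bar>pr f (\<iota> x)\<bar> \<le> norm (\<iota> x)"
    using pairing_le_norm[OF assms x(1)] W4_bounded[OF assms] x(1) by (simp add: pr_iota)
  also have "norm (\<iota> x) \<le> norm w + norm (\<iota> x - w)" by norm
  also have "norm w + norm (\<iota> x - w) + \<bar>pr f (\<iota> x - w)\<bar> \<le> norm w + norm (\<iota> x - w) * (K + 1)"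
    using K(2)[of "\<iota> x - w"] by (simp add: algebra_simps)
  also have "\<dots> \<le> norm w + e" using x(2) K(1) by (simp add: field_simps)
  finally show "\<bar>pr f w\<bar> \<le> norm w + e" by simp
qed

lemma W_nonempty: "{f. W f} \<noteq> {}"
  using W4_has_weight.unit[of 1 L1 L2 dec] by auto

text \<open>By density a functional that almost norms a nearby vector of \<open>c00\<close> will do.
  Closure of \<open>W\<close> under sign changes removes the modulus.\<close>

lemma exists_norming:
  assumes "0 < e"
  obtains f where "W f" "norm w - e < pr f w"
proof -
  have "0 < e / 3" using assms by simp
  then obtain x where x: "x \<in> c00" "norm (\<iota> x - w) < e / 3" using iota_approx by blast
  have "norm (\<iota> x) - e / 3 < (SUP f\<in>{f. W f}. \<bar>pairing f x\<bar>)"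
    using assms by (simp add: norm_iota[OF x(1)] X4_norm_def)
  then obtain f where f: "W f" "norm (\<iota> x) - e / 3 < \<bar>pairing f x\<bar>"
    using less_cSUP_iff[OF W_nonempty bdd_above_pairing] by auto
  have "\<bar>pr f (\<iota> x)\<bar> - \<bar>pr f (\<iota> x - w)\<bar> \<le> \<bar>pr f w\<bar>" by (simp add: pr.diff)
  moreover have "\<bar>pr f (\<iota> x - w)\<bar> \<le> norm (\<iota> x - w)" by (rule abs_pr_le_norm[OF f(1)])
  moreover have "norm w \<le> norm (\<iota> x) + norm (\<iota> x - w)" by norm
  moreover have "pr f (\<iota> x) = pairing f x" using f x W4_bounded pr_iota by blast
  ultimately have *: "norm w - e < \<bar>pr f w\<bar>" using f(2) x(2) by linarith
  have "W (\<lambda>i. - f i)"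
    using f(1) W4_bounded[OF f(1)]
    by (intro W4_has_weight.signs[OF f(1)]) (auto simp: absv_def c00_def supp_def)
  moreover have "pr (\<lambda>i. - f i) w = - pr f w" by (simp add: pr_def supp_def sum_negf)
  ultimately show thesis using * f(1) that by (cases "0 \<le> pr f w") auto
qed

text \<open>The modulus of \<open>f\<close> evaluated at the modulus of \<open>w\<close>. Since
  \<open>W\<close> is invariant under sign changes, the norm is the supremum of these values as
  well, and all later estimates deal with sums of nonnegative terms.\<close>

definition ap :: "vec \<Rightarrow> 'a \<Rightarrow> real" where
  "ap f w = (\<Sum>n\<in>supp f. \<bar>f n\<bar> * \<bar>coord n w\<bar>)"

lemma ap_superset:
  assumes "supp f \<subseteq> A" "finite A"
  shows "ap f w = (\<Sum>n\<in>A. \<bar>f n\<bar> * \<bar>coord n w\<bar>)"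
  unfolding ap_def using assms by (intro sum.mono_neutral_left) (auto simp: supp_def)

lemma ap_nonneg: "0 \<le> ap f w"
  by (simp add: ap_def sum_nonneg)

lemma ap_mono:
  assumes "f \<in> c00" "g \<in> c00" "\<And>i. \<bar>g i\<bar> \<le> \<bar>f i\<bar>"
  shows "ap g w \<le> ap f w"
proof -
  have "supp g \<subseteq> supp f"
  proof
    fix i assume "i \<in> supp g"
    then show "i \<in> supp f" using assms(3)[of i] by (auto simp: supp_def)
  qed
  then have "ap g w = (\<Sum>n\<in>supp f. \<bar>g n\<bar> * \<bar>coord n w\<bar>)"
    using assms(1) by (intro ap_superset) (auto simp: c00_def)
  also have "\<dots> \<le> ap f w" unfolding ap_def using assms(3) by (intro sum_mono mult_right_mono) auto
  finally show ?thesis .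
qed

lemma ap_coord_mono: "(\<And>n. \<bar>coord n v\<bar> \<le> \<bar>coord n w\<bar>) \<Longrightarrow> ap f v \<le> ap f w"
  unfolding ap_def by (intro sum_mono mult_left_mono) auto

lemma ap_sum_le: "ap f (\<Sum>r\<in>R. x r) \<le> (\<Sum>r\<in>R. ap f (x r))"
proof -
  have "ap f (\<Sum>r\<in>R. x r) \<le> (\<Sum>n\<in>supp f. \<Sum>r\<in>R. \<bar>f n\<bar> * \<bar>coord n (x r)\<bar>)"
    unfolding ap_def coord.sum sum_distrib_left[symmetric] by (intro sum_mono mult_left_mono sum_abs) auto
  also have "\<dots> = (\<Sum>r\<in>R. ap f (x r))" unfolding ap_def by (rule sum.swap)
  finally show ?thesis .
qed

lemma ap_scale: "ap f (c *\<^sub>R x) = \<bar>c\<bar> * ap f x"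
  by (simp add: ap_def coord.scaleR abs_mult sum_distrib_left ac_simps)

lemma ap_unit_vec: "ap (unit_vec n) w = \<bar>coord n w\<bar>"
  by (simp add: ap_def supp_unit_vec) (simp add: unit_vec_def)

text \<open>Flip the signs of \<open>f\<close> wherever they disagree with those of
  \<open>w\<close>; the new functional is still in \<open>W\<close> and attains the value
  \<open>ap f w\<close>.\<close>

lemma ap_le_norm:
  assumes "W f"
  shows "ap f w \<le> norm w"
proof -
  let ?g = "\<lambda>n. if 0 \<le> f n * coord n w then f n else - f n"
  have s: "supp ?g = supp f" by (auto simp: supp_def)
  have "W ?g"
    using W4_bounded[OF assms] s by (intro W4_has_weight.signs[OF assms]) (auto simp: absv_def c00_def)
  then have "\<bar>pr ?g w\<bar> \<le> norm w" by (rule abs_pr_le_norm)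
  moreover have "pr ?g w = ap f w"
    unfolding pr_def ap_def s by (rule sum.cong) (auto simp: abs_mult[symmetric])
  ultimately show ?thesis by linarith
qed

lemma abs_pr_le_ap: "\<bar>pr f w\<bar> \<le> ap f w"
  unfolding pr_def ap_def by (rule order_trans[OF sum_abs]) (simp add: abs_mult)

lemma norm_leI:
  assumes "\<And>f. W f \<Longrightarrow> ap f w \<le> B"
  shows "norm w \<le> B"
proof (rule field_le_epsilon)
  fix e :: real assume "0 < e"
  then obtain f where "W f" "norm w - e < pr f w" by (rule exists_norming)
  then show "norm w \<le> B + e" using assms[of f] abs_pr_le_ap[of f w] by linarith
qed

lemma unconditional:
  assumes "\<And>n. \<bar>coord n v\<bar> \<le> \<bar>coord n w\<bar>"
  shows "norm v \<le> norm w"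
  by (rule norm_leI) (use ap_coord_mono[OF assms] ap_le_norm in \<open>blast intro: order_trans\<close>)

lemma ap_op_result_le:
  assumes "block_seq fs" "0 \<le> \<theta>"
  shows "ap (op_result \<theta> fs) w \<le> \<theta> * (\<Sum>s<length fs. ap (fs ! s) w)"
proof -
  let ?A = "\<Union>s<length fs. supp (fs ! s)"
  have fin: "finite ?A" using assms(1) by (auto simp: block_seq_def c00_def)
  have "ap (op_result \<theta> fs) w = (\<Sum>n\<in>?A. \<bar>op_result \<theta> fs n\<bar> * \<bar>coord n w\<bar>)"
    by (rule ap_superset[OF supp_op_result fin])
  also have "\<dots> \<le> (\<Sum>n\<in>?A. \<Sum>s<length fs. \<theta> * (\<bar>(fs ! s) n\<bar> * \<bar>coord n w\<bar>))"
    using assms(2)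
    by (intro sum_mono)
      (auto simp: op_result_nth abs_mult sum_distrib_right[symmetric] sum_distrib_left[symmetric]
        mult.assoc intro!: mult_left_mono mult_right_mono)
  also have "\<dots> = \<theta> * (\<Sum>s<length fs. \<Sum>n\<in>?A. \<bar>(fs ! s) n\<bar> * \<bar>coord n w\<bar>)"
    by (subst sum.swap) (simp add: sum_distrib_left)
  also have "(\<Sum>s<length fs. \<Sum>n\<in>?A. \<bar>(fs ! s) n\<bar> * \<bar>coord n w\<bar>) = (\<Sum>s<length fs. ap (fs ! s) w)"
    using fin by (intro sum.cong refl ap_superset[symmetric]) auto
  finally show ?thesis .
qed

definition cs :: "'a \<Rightarrow> nat set" where
  "cs w = {n. coord n w \<noteq> 0}"

lemma ap_eq_0: "supp f \<inter> cs w = {} \<Longrightarrow> ap f w = 0"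
  unfolding ap_def by (rule sum.neutral) (auto simp: cs_def)

end

subsection \<open>Lower estimates and averages\<close>

text \<open>Successive sets can overlap only in an endpoint. Without their minima they are pairwise
  disjoint subsets of \<open>{..<n}\<close>, and the removed minima number at most
  \<open>k\<close>.\<close>

lemma sum_card_overlapping_le:
  fixes R :: "nat \<Rightarrow> nat set"
  assumes R: "\<And>s. s < k \<Longrightarrow> R s \<subseteq> {..<n}"
    and M: "\<And>s t a b. s < t \<Longrightarrow> t < k \<Longrightarrow> a \<in> R s \<Longrightarrow> b \<in> R t \<Longrightarrow> a \<le> b"
  shows "(\<Sum>s<k. card (R s)) \<le> n + k"
proof -
  let ?R = "\<lambda>s. R s - {Min (R s)}"
  have fin: "finite (R s)" if "s < k" for s using R[OF that] by (rule finite_subset) simp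
  have less: "Min (R s) < r" if "s < k" "r \<in> ?R s" for s r
    using that Min_le[OF fin, of s r] by fastforce
  have *: "?R s \<inter> ?R t = {}" if "s < t" "t < k" for s t
  proof (rule ccontr)
    assume "?R s \<inter> ?R t \<noteq> {}"
    then obtain r where r: "r \<in> R s" "r \<in> ?R t" by blast
    then have "Min (R t) \<in> R t" using fin[OF that(2)] by (intro Min_in) auto
    then show False using M[OF that r(1)] less[OF that(2) r(2)] by fastforce
  qed
  have disj: "?R s \<inter> ?R t = {}" if "s < k" "t < k" "s \<noteq> t" for s t
    using *[of s t] *[of t s] that by (cases "s < t") auto
  have "(\<Sum>s<k. card (?R s)) = card (\<Union>s<k. ?R s)"
    using fin disj by (subst card_UN_disjoint) auto
  also have "\<dots> \<le> card {..<n}" using R by (intro card_mono) blast+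
  finally have "(\<Sum>s<k. card (?R s)) \<le> n" by simp
  moreover have "(\<Sum>s<k. card (R s)) \<le> (\<Sum>s<k. card (?R s) + 1)"
  proof (intro sum_mono)
    fix s assume "s \<in> {..<k}"
    then show "card (R s) \<le> card (?R s) + 1" by (simp add: card_Diff_singleton_if, arith)
  qed
  then have "(\<Sum>s<k. card (R s)) \<le> (\<Sum>s<k. card (?R s)) + k" by (simp add: sum_Suc)
  ultimately show ?thesis by linarith
qed

context X4_completion
begin

text \<open>With \<open><\<close> this says that \<open>w\<close> comes after \<open>v\<close>, with
  \<open>\<noteq>\<close> that the supports are disjoint. The parameter allows
  \<open>grouping\<close> to treat both situations at once.\<close>

definition sep :: "(nat \<Rightarrow> nat \<Rightarrow> bool) \<Rightarrow> 'a \<Rightarrow> 'a \<Rightarrow> bool" where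
  "sep R v w \<longleftrightarrow> (\<forall>i\<in>cs v. \<forall>j\<in>cs w. R i j)"

lemma sepD: "sep R v w \<Longrightarrow> i \<in> cs v \<Longrightarrow> j \<in> cs w \<Longrightarrow> R i j"
  by (simp add: sep_def)

lemma cs_sum: "cs (\<Sum>r\<in>A. x r) \<subseteq> (\<Union>r\<in>A. cs (x r))"
  by (auto simp: cs_def coord.sum elim: sum.not_neutral_contains_not_neutral)

lemma cs_scale: "cs (c *\<^sub>R x) \<subseteq> cs x"
  by (auto simp: cs_def coord.scaleR)

lemma sep_sum:
  assumes "\<And>a b. a \<in> A \<Longrightarrow> b \<in> B \<Longrightarrow> sep R (x a) (x b)"
  shows "sep R (\<Sum>a\<in>A. x a) (\<Sum>b\<in>B. x b)"
  using assms cs_sum[of x A] cs_sum[of x B] unfolding sep_def by blast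

lemma sep_scale: "sep R v w \<Longrightarrow> sep R (c *\<^sub>R v) (d *\<^sub>R w)"
  using cs_scale unfolding sep_def by blast

text \<open>The coordinates separate points of the completion: a vector whose coordinates all vanish
  is dominated by 0, hence is 0 by unconditionality.\<close>

lemma cs_eq_empty: "cs w = {} \<longleftrightarrow> w = 0"
proof
  assume "cs w = {}"
  then have "norm w \<le> norm (0::'a)" by (intro unconditional) (auto simp: cs_def)
  then show "w = 0" by simp
qed (simp add: cs_def coord.zero)

lemma cs_pos: "n \<in> cs w \<Longrightarrow> 0 < n"
  using coord_0 by (auto simp: cs_def intro: gr0I)

text \<open>Cutting a norming functional down to the hull of the support of \<open>w\<close> leaves
  \<open>ap\<close> at \<open>w\<close> unchanged. Functionals obtained in this way for successive
  vectors form a block sequence.\<close>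

lemma exists_interval_norming:
  assumes "finite (cs w)" "0 \<le> c" "c < norm w"
  obtains g where "W g" "c < ap g w" "supp g \<noteq> {}" "supp g \<subseteq> {Min (cs w)..Max (cs w)}"
proof -
  obtain f where f: "W f" "norm w - (norm w - c) < pr f w"
    using exists_norming[of "norm w - c" w] assms by auto
  let ?g = "restr {Min (cs w)..Max (cs w)} f"
  have sub: "supp ?g \<subseteq> supp f" by (auto simp: supp_def restr_def)
  have fin: "finite (supp f)" using W4_bounded[OF f(1)] by (simp add: c00_def)
  have "ap ?g w = (\<Sum>n\<in>supp f. \<bar>?g n\<bar> * \<bar>coord n w\<bar>)" by (rule ap_superset[OF sub fin])
  also have "\<dots> = ap f w"
    unfolding ap_def
  proof (intro sum.cong refl)
    fix n
    have "n \<in> {Min (cs w)..Max (cs w)}" if "coord n w \<noteq> 0"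
    proof -
      have "n \<in> cs w" using that by (simp add: cs_def)
      then show ?thesis using assms(1) by simp
    qed
    then show "\<bar>?g n\<bar> * \<bar>coord n w\<bar> = \<bar>f n\<bar> * \<bar>coord n w\<bar>" by (auto simp: restr_def)
  qed
  finally have "c < ap ?g w" using f(2) abs_pr_le_ap[of f w] by linarith
  moreover have "supp ?g \<noteq> {}" using \<open>c < ap ?g w\<close> assms(2) by (auto simp: ap_def)
  moreover have "supp ?g \<subseteq> {Min (cs w)..Max (cs w)}"
    by (auto simp: supp_def restr_def split: if_splits)
  ultimately show thesis using W4_has_weight.interval[OF f(1)] that by blast
qed

text \<open>Functionals that almost norm the single vectors are combined by one even operation; each
  sees only its own vector of the sum, and the factor \<open>1 / m_seq (2 * j)\<close> is the only
  loss.\<close>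

lemma lower_estimate:
  fixes x :: "nat \<Rightarrow> 'a"
  assumes j: "1 \<le> j" and k: "real k \<le> n_seq (2 * j)" and \<rho>: "0 < \<rho>"
    and x: "\<And>t. t < k \<Longrightarrow> finite (cs (x t)) \<and> \<rho> \<le> norm (x t)"
    and succ: "\<And>s t. s < t \<Longrightarrow> t < k \<Longrightarrow> sep (<) (x s) (x t)"
  shows "real k * \<rho> / real (m_seq (2 * j)) \<le> norm (\<Sum>t<k. x t)"
proof (cases "k = 0")
  case False
  let ?m = "real (m_seq (2 * j))" and ?X = "\<Sum>t<k. x t"
  have m: "0 < ?m" using m_seq_pos[of "2 * j"] j by simp
  show ?thesis
  proof (rule field_le_mult_one_interval)
    \<comment> \<open>The norm is a supremum that need not be attained, so the functionals are
      chosen only up to a factor \<open>z < 1\<close>, which is arbitrary.\<close>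
    fix z :: real assume z: "0 < z" "z < 1"
    have "\<exists>g. W g \<and> z * \<rho> < ap g (x t) \<and> supp g \<noteq> {} \<and> supp g \<subseteq> {Min (cs (x t))..Max (cs (x t))}"
      if "t < k" for t
    proof -
      have "z * \<rho> < 1 * \<rho>" using z(2) \<rho> by (rule mult_strict_right_mono)
      then have "z * \<rho> < norm (x t)" using x[OF that] by simp
      moreover have "0 \<le> z * \<rho>" using z \<rho> by simp
      moreover have "finite (cs (x t))" using x[OF that] by simp
      ultimately obtain g where "W g" "z * \<rho> < ap g (x t)" "supp g \<noteq> {}"
          "supp g \<subseteq> {Min (cs (x t))..Max (cs (x t))}"
        by (metis exists_interval_norming)
      then show ?thesis by blast
    qed
    then obtain g where g: "\<And>t. t < k \<Longrightarrow> W (g t)" "\<And>t. t < k \<Longrightarrow> z * \<rho> < ap (g t) (x t)"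
        "\<And>t. t < k \<Longrightarrow> supp (g t) \<noteq> {}" "\<And>t. t < k \<Longrightarrow> supp (g t) \<subseteq> {Min (cs (x t))..Max (cs (x t))}"
      by metis
    have fin: "finite (supp (g t))" if "t < k" for t
      using g(4)[OF that] by (rule finite_subset) simp
    have ne: "cs (x t) \<noteq> {}" if "t < k" for t
      using x[OF that] \<rho> by (auto simp: cs_eq_empty)
    have hull: "Max (cs (x s)) < Min (cs (x t))" if "s < t" "t < k" for s t
    proof -
      have "Max (cs (x s)) \<in> cs (x s)" "Min (cs (x t)) \<in> cs (x t)"
        using x ne that by (auto intro!: Max_in Min_in)
      then show ?thesis using succ[OF that] by (auto simp: sep_def)
    qed
    have less: "i < i'" if "s < t" "t < k" "i \<in> supp (g s)" "i' \<in> supp (g t)" for s t i i'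
      using hull[OF that(1,2)] g(4)[of s] g(4)[of t] that by fastforce
    let ?fs = "map g [0..<k]"
    have bs: "block_seq ?fs"
      unfolding block_seq_def
    proof
      show "\<forall>f\<in>set ?fs. f \<in> c00 \<and> supp f \<noteq> {}" using g W4_bounded by fastforce
      have "maxsupp (g s) < minsupp (g t)" if "s < t" "t < k" for s t
        unfolding maxsupp_def minsupp_def
        using less[OF that] that fin g(3) Max_in[of "supp (g s)"] Min_in[of "supp (g t)"] by simp
      then show "sorted_wrt (\<lambda>f g. maxsupp f < minsupp g) ?fs"
        by (simp add: sorted_wrt_iff_nth_less)
    qed
    let ?f = "op_result (1 / ?m) ?fs"
    have "has_weight L1 L2 dec (2 * j) ?f"
      using False k bs g(1) by (intro W4_has_weight.even_operation j) auto
    then have Wf: "W ?f" by (rule W4_has_weight.weighted)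
    have f_at: "?f n = (1 / ?m) * g t n" if "t < k" "n \<in> supp (g t)" for t n
      using op_result_at[OF bs, of t n] that by simp
    have coord_X: "coord n ?X = coord n (x t)" if "t < k" "n \<in> supp (g t)" for t n
    proof -
      have "coord n (x s) = 0" if "s < k" "s \<noteq> t" for s
      proof (rule ccontr)
        assume "coord n (x s) \<noteq> 0"
        then have "n \<in> cs (x s)" by (simp add: cs_def)
        then have "Min (cs (x s)) \<le> n" "n \<le> Max (cs (x s))" using x[OF \<open>s < k\<close>] by auto
        moreover have "Min (cs (x t)) \<le> n" "n \<le> Max (cs (x t))"
          using g(4)[OF \<open>t < k\<close>] \<open>n \<in> supp (g t)\<close> by auto
        ultimately show False
          using hull[of s t] hull[of t s] that \<open>t < k\<close> by (cases "s < t") auto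
      qed
      then show ?thesis
        using that(1) by (simp add: coord.sum) (subst sum.remove[of _ t], auto)
    qed
    have "z * (real k * \<rho> / ?m) = (1 / ?m) * (\<Sum>t<k. z * \<rho>)" by simp
    also have "\<dots> \<le> (1 / ?m) * (\<Sum>t<k. ap (g t) (x t))"
      using g(2) by (intro mult_left_mono sum_mono) (auto intro: less_imp_le)
    also have "\<dots> = (\<Sum>t<k. \<Sum>n\<in>supp (g t). \<bar>?f n\<bar> * \<bar>coord n ?X\<bar>)"
      by (simp add: ap_def f_at coord_X sum_distrib_left abs_mult mult.assoc)
    also have "\<dots> = (\<Sum>n\<in>(\<Union>t<k. supp (g t)). \<bar>?f n\<bar> * \<bar>coord n ?X\<bar>)"
    proof (rule sum.UNION_disjoint[symmetric])
      show "\<forall>s\<in>{..<k}. \<forall>t\<in>{..<k}. s \<noteq> t \<longrightarrow> supp (g s) \<inter> supp (g t) = {}"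
      proof (intro ballI impI equals0I)
        fix s t i assume "s \<in> {..<k}" "t \<in> {..<k}" "s \<noteq> t" "i \<in> supp (g s) \<inter> supp (g t)"
        then show False using less[of s t i i] less[of t s i i] by (cases "s < t") auto
      qed
    qed (use fin in auto)
    also have "\<dots> = ap ?f ?X"
      using fin supp_op_result[of "1 / ?m" ?fs] by (intro ap_superset[symmetric]) auto
    also have "\<dots> \<le> norm ?X" by (rule ap_le_norm[OF Wf])
    finally show "z * (real k * \<rho> / ?m) \<le> norm ?X" .
  qed
qed simp

text \<open>James' submultiplicativity argument. Taking \<open>P \<rho> v\<close> to be \<open>norm v \<le> \<rho>\<close> or \<open>\<rho> \<le> norm v\<close>, it
  serves both for \<open>l\<^sub>1\<close>-averages and for cubes.\<close>

lemma grouping: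
  fixes x :: "nat \<Rightarrow> 'a" and P :: "real \<Rightarrow> 'a \<Rightarrow> bool"
  assumes V: "subspace V" and \<beta>: "0 < \<beta>"
    and scale: "\<And>c \<rho> v. 0 < c \<Longrightarrow> P \<rho> v \<Longrightarrow> P (c * \<rho>) (c *\<^sub>R v)"
    and base: "\<And>x. (\<And>t. t < n \<Longrightarrow> x t \<in> V \<and> P 1 (x t)) \<Longrightarrow>
      (\<And>s t. s < t \<Longrightarrow> t < n \<Longrightarrow> sep R (x s) (x t)) \<Longrightarrow> P \<beta> (\<Sum>t<n. x t)"
    and x: "\<And>t. t < n ^ k \<Longrightarrow> x t \<in> V \<and> P 1 (x t)"
    and R: "\<And>s t. s < t \<Longrightarrow> t < n ^ k \<Longrightarrow> sep R (x s) (x t)"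
  shows "P (\<beta> ^ k) (\<Sum>t<n ^ k. x t)"
  using x R
proof (induction k arbitrary: x)
  case (Suc k)
  let ?m = "n ^ k"
  define d where "d q = (\<Sum>r\<in>{q * ?m..<q * ?m + ?m}. x r)" for q
  have bound: "r < n ^ Suc k" if "q < n" "r \<in> {q * ?m..<q * ?m + ?m}" for q r
  proof -
    have "r < (q + 1) * ?m" using that by simp
    also have "\<dots> \<le> n * ?m" using that(1) by (intro mult_right_mono) auto
    finally show ?thesis by simp
  qed
  have d: "d q \<in> V \<and> P (\<beta> ^ k) (d q)" if "q < n" for q
  proof
    show "d q \<in> V"
      unfolding d_def using Suc.prems(1) bound[OF that] by (intro subspace_sum[OF V]) auto
    have "P (\<beta> ^ k) (\<Sum>r<?m. x (q * ?m + r))"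
      using Suc.prems bound[OF that] by (intro Suc.IH) auto
    moreover have "(\<Sum>r<?m. x (q * ?m + r)) = d q"
      unfolding d_def by (rule sum.reindex_bij_witness[of _ "\<lambda>r. r - q * ?m" "\<lambda>r. q * ?m + r"]) auto
    ultimately show "P (\<beta> ^ k) (d q)" by simp
  qed
  have sep_d: "sep R (d q) (d q')" if "q < q'" "q' < n" for q q'
    unfolding d_def
  proof (rule sep_sum)
    fix a b assume a: "a \<in> {q * ?m..<q * ?m + ?m}" and b: "b \<in> {q' * ?m..<q' * ?m + ?m}"
    have "(q + 1) * ?m \<le> q' * ?m" using that by (intro mult_right_mono) auto
    then have "a < b" using a b by simp
    then show "sep R (x a) (x b)" using Suc.prems(2) bound[OF that(2) b] by blast
  qed
  \<comment> \<open>The group sums are rescaled to satisfy \<open>P 1\<close> again, so that the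
    base case contributes one further factor \<open>\<beta>\<close>.\<close>
  have "P \<beta> (\<Sum>q<n. (1 / \<beta> ^ k) *\<^sub>R d q)"
  proof (rule base)
    fix q assume "q < n"
    then show "(1 / \<beta> ^ k) *\<^sub>R d q \<in> V \<and> P 1 ((1 / \<beta> ^ k) *\<^sub>R d q)"
      using d[of q] scale[of "1 / \<beta> ^ k" "\<beta> ^ k" "d q"] \<beta> V by (auto intro: subspace_scale)
  qed (auto intro: sep_scale sep_d)
  then have "P (\<beta> ^ k * \<beta>) (\<beta> ^ k *\<^sub>R (\<Sum>q<n. (1 / \<beta> ^ k) *\<^sub>R d q))"
    using \<beta> by (intro scale) auto
  also have "\<beta> ^ k *\<^sub>R (\<Sum>q<n. (1 / \<beta> ^ k) *\<^sub>R d q) = (\<Sum>q<n. d q)"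
    using \<beta> by (simp add: scaleR_sum_right)
  also have "\<dots> = (\<Sum>t<n ^ Suc k. x t)"
    unfolding d_def by (simp add: sum.nat_group)
  finally show ?case by (simp add: mult.commute)
next
  case 0
  then show ?case by simp
qed

section \<open>Averages of \<open>l\<^sub>1\<close>-type in the span of a block sequence\<close>

definition blocks :: "(nat \<Rightarrow> 'a) \<Rightarrow> bool" where
  "blocks u \<longleftrightarrow> (\<forall>t. finite (cs (u t)) \<and> norm (u t) = 1) \<and> (\<forall>s t. s < t \<longrightarrow> sep (<) (u s) (u t))"

lemma blocks_cs_greater:
  assumes "blocks u" "i \<in> cs (u t)"
  shows "t < i"
  using assms(2)
proof (induction t arbitrary: i)
  case 0
  then show ?case by (rule cs_pos)
next
  case (Suc t)
  have "norm (u t) = 1" using assms(1) by (simp add: blocks_def)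
  then have "cs (u t) \<noteq> {}" by (auto simp: cs_eq_empty)
  then obtain j where j: "j \<in> cs (u t)" by blast
  have "sep (<) (u t) (u (Suc t))" using assms(1) by (simp add: blocks_def)
  then have "j < i" using j Suc.prems by (rule sepD)
  then show ?case using Suc.IH[OF j] by simp
qed

lemma subspace_finite_cs: "subspace {v \<in> span B. finite (cs v) \<and> cs v \<subseteq> A}"
proof -
  have add: "cs (v + w) \<subseteq> cs v \<union> cs w" for v w by (auto simp: cs_def coord.add)
  show ?thesis
  proof (rule subspaceI)
    show "0 \<in> {v \<in> span B. finite (cs v) \<and> cs v \<subseteq> A}"
      using cs_eq_empty[of 0] by (simp add: span_zero)
    show "v + w \<in> {v \<in> span B. finite (cs v) \<and> cs v \<subseteq> A}"
      if "v \<in> {v \<in> span B. finite (cs v) \<and> cs v \<subseteq> A}" "w \<in> {v \<in> span B. finite (cs v) \<and> cs v \<subseteq> A}" for v w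
      using that add[of v w] finite_subset[OF add[of v w]] by (auto simp: span_add)
    show "c *\<^sub>R v \<in> {v \<in> span B. finite (cs v) \<and> cs v \<subseteq> A}"
      if "v \<in> {v \<in> span B. finite (cs v) \<and> cs v \<subseteq> A}" for c v
      using that cs_scale[of c v] finite_subset[OF cs_scale[of c v]] by (auto simp: span_scale)
  qed
qed

text \<open>If \<open>b < a\<close>, the support of \<open>x b\<close> would precede that of
  \<open>x a\<close>, although a later functional meets \<open>x b\<close>. This is the ordering
  hypothesis of \<open>sum_card_overlapping_le\<close>.\<close>

lemma hits_mono:
  fixes x :: "nat \<Rightarrow> 'a"
  assumes "block_seq fs" "\<And>a b. a < b \<Longrightarrow> b \<in> I \<Longrightarrow> a \<in> I \<Longrightarrow> sep (<) (x a) (x b)"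
    and "s < t" "t < length fs" "a \<in> I" "b \<in> I"
    and "supp (fs ! s) \<inter> cs (x a) \<noteq> {}" "supp (fs ! t) \<inter> cs (x b) \<noteq> {}"
  shows "a \<le> b"
proof (rule ccontr)
  assume "\<not> a \<le> b"
  obtain i j where "i \<in> supp (fs ! s)" "i \<in> cs (x a)" "j \<in> supp (fs ! t)" "j \<in> cs (x b)"
    using assms(7,8) by blast
  moreover have "sep (<) (x b) (x a)" using assms(2)[of b a] assms(5,6) \<open>\<not> a \<le> b\<close> by (simp add: not_le)
  ultimately have "i < j" "j < i"
    using block_seq_disjoint[OF assms(1,3,4)] sepD by blast+
  then show False by simp
qed

text \<open>Each functional contributes at most 1 for every vector that it meets, and by
  \<open>sum_card_overlapping_le\<close> there are at most \<open>n + length fs\<close> such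
  incidences.\<close>

lemma sum_ap_average_le:
  fixes x :: "nat \<Rightarrow> 'a"
  assumes fs: "block_seq fs" "\<forall>f\<in>set fs. W f"
    and x: "\<And>t. t < n \<Longrightarrow> norm (x t) \<le> 1" "\<And>s t. s < t \<Longrightarrow> t < n \<Longrightarrow> sep (<) (x s) (x t)"
  shows "(\<Sum>s<length fs. ap (fs ! s) (\<Sum>t<n. x t)) \<le> real (n + length fs)"
proof -
  define R where "R s = {t \<in> {..<n}. supp (fs ! s) \<inter> cs (x t) \<noteq> {}}" for s
  have "(\<Sum>s<length fs. card (R s)) \<le> n + length fs"
  proof (rule sum_card_overlapping_le)
    fix s t a b assume "s < t" "t < length fs" "a \<in> R s" "b \<in> R t"
    then show "a \<le> b"
      using hits_mono[OF fs(1), of "{..<n}" x s t a b] x(2) by (auto simp: R_def)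
  qed (auto simp: R_def)
  then have "real (\<Sum>s<length fs. card (R s)) \<le> real (n + length fs)" by (rule of_nat_mono)
  moreover have "ap (fs ! s) (\<Sum>t<n. x t) \<le> real (card (R s))" if "s < length fs" for s
  proof -
    have "ap (fs ! s) (\<Sum>t<n. x t) \<le> (\<Sum>t<n. ap (fs ! s) (x t))" by (rule ap_sum_le)
    also have "\<dots> = (\<Sum>t\<in>R s. ap (fs ! s) (x t))"
      by (intro sum.mono_neutral_right) (auto simp: R_def ap_eq_0)
    also have "\<dots> \<le> (\<Sum>t\<in>R s. 1)"
    proof (rule sum_mono)
      fix t assume "t \<in> R s"
      then show "ap (fs ! s) (x t) \<le> 1"
        using ap_le_norm[of "fs ! s" "x t"] fs(2) that x(1)[of t] by (fastforce simp: R_def)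
    qed
    finally show ?thesis by simp
  qed
  then have "(\<Sum>s<length fs. ap (fs ! s) (\<Sum>t<n. x t)) \<le> (\<Sum>s<length fs. real (card (R s)))"
    by (intro sum_mono) auto
  ultimately show ?thesis by (simp only: of_nat_sum)
qed

text \<open>Otherwise successive \<open>n\<close>-tuples always have sums of norm at most
  \<open>n / 2\<close>. By \<open>grouping\<close>, a sum of \<open>n ^ k\<close> blocks then has
  norm at most \<open>(n / 2) ^ k\<close>, which contradicts the lower estimate by one even
  operation.\<close>

lemma exists_l1_tuple:
  assumes u: "blocks u" and n: "1 \<le> n"
  obtains x where "\<And>t. t < n \<Longrightarrow> x t \<in> span (range u) \<and> finite (cs (x t)) \<and> cs (x t) \<subseteq> {K<..} \<and> norm (x t) \<le> 1"
    "\<And>s t. s < t \<Longrightarrow> t < n \<Longrightarrow> sep (<) (x s) (x t)" "real n / 2 \<le> norm (\<Sum>t<n. x t)"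
proof (rule ccontr)
  note witness = that
  assume neg: "\<not> thesis"
  define V where "V = {v \<in> span (range u). finite (cs v) \<and> cs v \<subseteq> {K<..}}"
  obtain j where j: "1 \<le> j" "real n \<le> n_seq (2 * j - 1)" using n_seq_unbounded by blast
  obtain i where i: "2 * j = Suc i" "1 \<le> i" using j by (cases "2 * j") auto
  \<comment> \<open>As \<open>m_seq (2 * j) = 2 ^ 5 ^ i\<close>, this makes \<open>2 ^ k\<close>
    twice as large as \<open>m_seq (2 * j)\<close>, while \<open>k \<le> 3 * 5 ^ i\<close> still
    gives \<open>n ^ k \<le> n_seq (2 * j)\<close>.\<close>
  define k :: nat where "k = 5 ^ i + 1"
  \<comment> \<open>Since the support of \<open>u t\<close> lies beyond \<open>t\<close>, shifting
    the index by \<open>K\<close> pushes all supports beyond \<open>K\<close>.\<close>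
  let ?x = "\<lambda>t. u (t + K)"
  have "norm (\<Sum>t<n ^ k. ?x t) \<le> (real n / 2) ^ k"
  proof (rule grouping[where P = "\<lambda>\<rho> v. norm v \<le> \<rho>" and V = V and R = "(<)"])
    show "subspace V" unfolding V_def by (rule subspace_finite_cs)
    show "0 < real n / 2" using n by simp
    show "norm (c *\<^sub>R v) \<le> c * \<rho>" if "0 < c" "norm v \<le> \<rho>" for c \<rho> v using that by simp
    show "norm (\<Sum>t<n. x t) \<le> real n / 2"
      if "\<And>t. t < n \<Longrightarrow> x t \<in> V \<and> norm (x t) \<le> 1" "\<And>s t. s < t \<Longrightarrow> t < n \<Longrightarrow> sep (<) (x s) (x t)" for x
    proof (rule ccontr)
      assume "\<not> norm (\<Sum>t<n. x t) \<le> real n / 2"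
      then have "thesis" using that by (intro witness[of x]) (auto simp: V_def)
      with neg show False by blast
    qed
    show "?x t \<in> V \<and> norm (?x t) \<le> 1" for t
      using u blocks_cs_greater[OF u, of _ "t + K"]
      by (fastforce simp: V_def blocks_def intro: span_base)
    show "sep (<) (?x s) (?x t)" if "s < t" for s t using u that by (simp add: blocks_def)
  qed
  moreover have "real (n ^ k) * 1 / real (m_seq (2 * j)) \<le> norm (\<Sum>t<n ^ k. ?x t)"
  proof (rule lower_estimate[OF j(1)])
    have "1 * n_seq i \<le> 15 * n_seq i" using n_seq_ge_4[OF i(2)] by (intro mult_right_mono) auto
    then have "real n \<le> 15 * n_seq i" using j(2) i(1) by simp
    then have "real n ^ k \<le> (15 * n_seq i) ^ k" by (intro power_mono) auto
    also have "\<dots> \<le> (15 * n_seq i) ^ (3 * 5 ^ i)"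
      using n_seq_ge_4[OF i(2)] by (intro power_increasing) (auto simp: Suc_le_eq k_def)
    finally show "real (n ^ k) \<le> n_seq (2 * j)" using i by (simp add: n_seq_Suc)
  qed (use u in \<open>auto simp: blocks_def\<close>)
  ultimately have "real n ^ k / real (m_seq (2 * j)) \<le> (real n / 2) ^ k" by (simp only: of_nat_power mult_1_right)
  also have "\<dots> = real n ^ k / (2 * real (m_seq (2 * j)))"
    by (simp add: power_divide i m_seq_eq k_def)
  finally show False using n m_seq_pos[of "2 * j"] j by (simp add: field_simps)
qed

text \<open>Twice the average of an \<open>n\<close>-tuple from \<open>exists_l1_tuple\<close>: the
  factor 2 brings the norm above 1, and at most \<open>n\<close> functionals give a total of at most
  \<open>(2 / n) * (n + n) = 4\<close>.\<close>

lemma l1_average: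
  assumes u: "blocks u" and n: "1 \<le> n"
  obtains z where "z \<in> span (range u)" "finite (cs z)" "cs z \<subseteq> {K<..}" "1 \<le> norm z" "norm z \<le> 2"
    "\<forall>fs. block_seq fs \<and> (\<forall>f\<in>set fs. W f) \<and> length fs \<le> n \<longrightarrow> (\<Sum>s<length fs. ap (fs ! s) z) \<le> 4"
proof -
  obtain x where x: "\<And>t. t < n \<Longrightarrow> x t \<in> span (range u) \<and> finite (cs (x t)) \<and> cs (x t) \<subseteq> {K<..} \<and> norm (x t) \<le> 1"
    "\<And>s t. s < t \<Longrightarrow> t < n \<Longrightarrow> sep (<) (x s) (x t)" "real n / 2 \<le> norm (\<Sum>t<n. x t)"
    using exists_l1_tuple[OF assms, where K = K] by metis
  let ?X = "\<Sum>t<n. x t"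
  let ?z = "(2 / real n) *\<^sub>R ?X"
  have "?X \<in> {v \<in> span (range u). finite (cs v) \<and> cs v \<subseteq> {K<..}}"
    using x(1) by (intro subspace_sum subspace_finite_cs) auto
  then have "?z \<in> {v \<in> span (range u). finite (cs v) \<and> cs v \<subseteq> {K<..}}"
    by (rule subspace_scale[OF subspace_finite_cs])
  moreover have "1 \<le> norm ?z" using x(3) n by (simp add: field_simps)
  moreover have "norm ?X \<le> (\<Sum>t<n. 1)" using x(1) by (intro norm_sum[THEN order_trans] sum_mono) auto
  then have "norm ?z \<le> 2" using n by (simp add: field_simps)
  moreover have "(\<Sum>s<length fs. ap (fs ! s) ?z) \<le> 4"
    if fs: "block_seq fs" "\<forall>f\<in>set fs. W f" "length fs \<le> n" for fs
  proof -
    have "(\<Sum>s<length fs. ap (fs ! s) ?z) = (2 / real n) * (\<Sum>s<length fs. ap (fs ! s) ?X)"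
      by (simp add: ap_scale sum_distrib_left)
    also have "\<dots> \<le> (2 / real n) * real (n + length fs)"
      using sum_ap_average_le[OF fs(1,2), of n x] x by (intro mult_left_mono) auto
    also have "\<dots> \<le> (2 / real n) * (2 * real n)" using fs(3) by (intro mult_left_mono) auto
    also have "\<dots> = 4" using n by simp
    finally show ?thesis .
  qed
  ultimately show thesis by (intro that[of ?z]) auto
qed

end

subsection \<open>The interlaced index sets\<close>

text \<open>Jensen's inequality, obtained from Young's inequality at the mean value.\<close>

lemma sum_powr_le:
  fixes h :: "'b \<Rightarrow> real"
  assumes S: "finite S" and h: "\<And>s. s \<in> S \<Longrightarrow> 0 \<le> h s" and \<delta>: "0 < \<delta>" "\<delta> < 1"
    and B: "real (card S) \<le> B"
  shows "(\<Sum>s\<in>S. h s powr (1 - \<delta>)) \<le> B powr \<delta> * (\<Sum>s\<in>S. h s) powr (1 - \<delta>)"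
proof (cases "(\<Sum>s\<in>S. h s) = 0")
  case True
  then have "\<forall>s\<in>S. h s = 0" using S h by (simp add: sum_nonneg_eq_0_iff)
  then show ?thesis by (simp add: True)
next
  case False
  let ?H = "\<Sum>s\<in>S. h s"
  have H: "0 < ?H" using False h by (simp add: order_less_le sum_nonneg)
  have "S \<noteq> {}" using False by auto
  then have n: "0 < real (card S)" using S by (simp add: card_gt_0_iff)
  define b where "b = ?H / real (card S)"
  have b: "0 < b" using H n by (simp add: b_def)
  have "h s powr (1 - \<delta>) * b powr \<delta> \<le> (1 - \<delta>) * h s + \<delta> * b" if "s \<in> S" for s
  proof (cases "h s = 0")
    case False
    then show ?thesis using h[OF that] b \<delta> by (intro Youngs_inequality_0) auto
  qed (use b \<delta> in simp)
  then have "(\<Sum>s\<in>S. h s powr (1 - \<delta>) * b powr \<delta>) \<le> (\<Sum>s\<in>S. (1 - \<delta>) * h s + \<delta> * b)"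
    by (rule sum_mono)
  also have "\<dots> = (1 - \<delta>) * ?H + \<delta> * (real (card S) * b)"
    by (simp add: sum.distrib sum_distrib_left)
  also have "\<dots> = ?H" using n by (simp add: b_def algebra_simps)
  finally have "(\<Sum>s\<in>S. h s powr (1 - \<delta>)) * b powr \<delta> \<le> ?H" by (simp add: sum_distrib_right)
  then have "(\<Sum>s\<in>S. h s powr (1 - \<delta>)) \<le> ?H / b powr \<delta>" using b by (simp add: field_simps)
  also have "\<dots> = real (card S) powr \<delta> * ?H powr (1 - \<delta>)"
    using H n by (simp add: b_def powr_divide powr_diff)
  also have "\<dots> \<le> B powr \<delta> * ?H powr (1 - \<delta>)"
    using B \<delta> by (intro mult_right_mono powr_mono2) auto
  finally show ?thesis .
qed

text \<open>The vector \<open>y\<^sub>k\<close> of the construction will be \<open>c k\<close> times the sum of the blocks with index in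
  \<open>A k\<close>. The function \<open>\<Phi>\<close> of the interval \<open>{p..<q}\<close> is a supersolution of the implicit equation of
  the norm, see \<open>sum_\<Phi>_le\<close>. The exponent \<open>\<delta> k\<close> makes \<open>n\<^sub>i powr \<delta> k \<le> 2\<close> for \<open>i \<le> 2k + 1\<close>, whereas
  \<open>n\<^sub>i powr \<delta> k = m\<^sub>i ^ 3\<close> for \<open>i = 2k + 2\<close>.\<close>

locale interlacing =
  fixes l :: nat
  assumes l_pos: "1 \<le> l"
begin

text \<open>\<open>A k\<close> is an arithmetic progression with difference \<open>step k\<close>
  and \<open>N / step k\<close> terms, so it is spread evenly over \<open>{..<N}\<close>. As
  \<open>l\<close> divides \<open>step k\<close>, all its members are congruent to \<open>k\<close>
  modulo \<open>l\<close>, which keeps the progressions disjoint.\<close>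

definition N :: nat where "N = l * (\<Prod>k<l. n_nat (2 * k + 2))"
definition step :: "nat \<Rightarrow> nat" where "step k = l * (\<Prod>i\<in>{..<l} - {k}. n_nat (2 * i + 2))"
definition A :: "nat \<Rightarrow> nat set" where "A k = (\<lambda>t. t * step k + k) ` {..<n_nat (2 * k + 2)}"
definition c :: "nat \<Rightarrow> real" where "c k = real (m_seq (2 * k + 2)) / n_seq (2 * k + 2)"
definition \<delta> :: "nat \<Rightarrow> real" where "\<delta> k = 1 / log 2 (15 * n_seq (2 * k + 1))"
definition h :: "nat \<Rightarrow> nat \<Rightarrow> nat \<Rightarrow> real" where "h k p q = real (card (A k \<inter> {p..<q}))"
definition \<mu> :: "nat \<Rightarrow> nat \<Rightarrow> real" where "\<mu> p q = real (card {p..<q}) / real N"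
definition \<Phi> :: "nat \<Rightarrow> nat \<Rightarrow> real" where
  "\<Phi> p q = 16 * \<mu> p q + (\<Sum>k<l. c k * h k p q powr (1 - \<delta> k))"
definition a :: "nat \<Rightarrow> real" where "a r = (\<Sum>k<l. if r \<in> A k then c k else 0)"

lemma n_nat_pos: "1 \<le> j \<Longrightarrow> 0 < n_nat j"
  using n_seq_ge_4[of j] by (simp flip: real_n_nat)

lemma N_pos: "0 < N"
  using l_pos by (auto simp: N_def n_nat_pos)

lemma N_eq: "k < l \<Longrightarrow> N = n_nat (2 * k + 2) * step k"
  by (simp add: N_def step_def prod.remove[of "{..<l}" k])

lemma l_dvd_step: "l dvd step k"
  by (simp add: step_def)

lemma step_ge: "k < l \<Longrightarrow> l \<le> step k"
  using N_pos N_eq[of k] by (intro dvd_imp_le[OF l_dvd_step]) (auto intro: gr0I)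

lemma A_less_N:
  assumes "k < l" "r \<in> A k"
  shows "r < N"
proof -
  obtain t where t: "t < n_nat (2 * k + 2)" "r = t * step k + k" using assms(2) by (auto simp: A_def)
  then have "r < (t + 1) * step k" using step_ge[OF assms(1)] assms(1) by simp
  also have "\<dots> \<le> n_nat (2 * k + 2) * step k" using t(1) by (intro mult_right_mono) auto
  finally show ?thesis using N_eq[OF assms(1)] by simp
qed

lemma A_disjoint:
  assumes "k < l" "k' < l" "k \<noteq> k'"
  shows "A k \<inter> A k' = {}"
proof -
  have "r mod l = i" if i: "i < l" and r: "r \<in> A i" for r i
  proof -
    obtain d where "step i = l * d" using l_dvd_step[of i] by auto
    then obtain t where "r = i + l * (t * d)" using r by (auto simp: A_def algebra_simps)
    then show ?thesis using i by simp
  qed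
  then show ?thesis using assms by blast
qed

lemma inj_A: "k < l \<Longrightarrow> inj_on (\<lambda>t. t * step k + k) {..<n_nat (2 * k + 2)}"
  using step_ge[of k] by (auto simp: inj_on_def)

lemma finite_A: "finite (A k)"
  by (simp add: A_def)

lemma card_A: "k < l \<Longrightarrow> card (A k) = n_nat (2 * k + 2)"
  unfolding A_def by (subst card_image[OF inj_A]) auto

lemma c_pos: "0 < c k"
  using m_seq_pos[of "2 * k + 2"] n_seq_ge_4[of "2 * k + 2"] by (simp add: c_def)

lemma c_nonneg: "0 \<le> c k"
  using c_pos[of k] by simp

lemma \<delta>_bounds: "0 < \<delta> k" "\<delta> k < 1"
proof -
  have "log 2 2 < log 2 (15 * n_seq (2 * k + 1))"
    using n_seq_ge_4[of "2 * k + 1"] by (subst log_less_cancel_iff) auto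
  then show "0 < \<delta> k" "\<delta> k < 1" by (auto simp: \<delta>_def)
qed

text \<open>Raised to the power \<open>3 * 5 ^ (2 * k + 1)\<close>, this yields
  \<open>n_seq (2 * k + 2) powr \<delta> k = m_seq (2 * k + 2) ^ 3\<close>, which is what
  \<open>\<Phi>_total\<close> uses.\<close>

lemma powr_\<delta>: "(15 * n_seq (2 * k + 1)) powr \<delta> k = 2"
proof -
  let ?b = "15 * n_seq (2 * k + 1)"
  have b: "2 < ?b" using n_seq_ge_4[of "2 * k + 1"] by simp
  have "ln ?b / ln 2 = log 2 ?b" by (simp add: log_def)
  then have "\<delta> k * ln ?b = ln 2" using b by (simp add: \<delta>_def log_def)
  then show ?thesis using b by (simp add: powr_def)
qed

lemma h_nonneg: "0 \<le> h k p q"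
  by (simp add: h_def)

lemma \<mu>_nonneg: "0 \<le> \<mu> p q"
  by (simp add: \<mu>_def)

lemma \<Phi>_nonneg: "0 \<le> \<Phi> p q"
  unfolding \<Phi>_def by (intro add_nonneg_nonneg sum_nonneg) (simp_all add: c_nonneg \<mu>_nonneg)

text \<open>Two points of a progression are at least \<open>step k\<close> apart, so
  \<open>(h - 1) * step k\<close> is at most the length of the interval. If \<open>h\<close> exceeds
  1, then \<open>h \<le> 2 * (h - 1)\<close>. Equidistribution of \<open>A k\<close> enters
  here.\<close>

lemma h_le: "k < l \<Longrightarrow> h k p q \<le> 1 \<or> h k p q \<le> 2 * n_seq (2 * k + 2) * \<mu> p q"
proof -
  assume k: "k < l"
  let ?n = "n_nat (2 * k + 2)"
  define T where "T = {t \<in> {..<?n}. t * step k + k \<in> {p..<q}}"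
  have fin: "finite T" by (simp add: T_def)
  have "A k \<inter> {p..<q} = (\<lambda>t. t * step k + k) ` T" by (auto simp: A_def T_def)
  moreover have "T \<subseteq> {..<?n}" by (auto simp: T_def)
  ultimately have hT: "h k p q = real (card T)"
    unfolding h_def by (simp only: card_image[OF inj_on_subset[OF inj_A[OF k]]])
  show ?thesis
  proof (cases "card T \<le> 1")
    case True
    then show ?thesis by (simp add: hT)
  next
    case False
    then have ne: "T \<noteq> {}" by auto
    then have mem: "Min T \<in> T" "Max T \<in> T" using fin by auto
    have "T \<subseteq> {Min T..Max T}" using fin by auto
    then have "card T \<le> card {Min T..Max T}" by (intro card_mono) auto
    then have "card T - 1 \<le> Max T - Min T" by simp
    then have "(card T - 1) * step k \<le> (Max T - Min T) * step k" by (intro mult_right_mono) auto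
    also have "\<dots> = Max T * step k - Min T * step k" by (rule diff_mult_distrib)
    also have "\<dots> \<le> card {p..<q}" using mem by (auto simp: T_def)
    finally have "real ((card T - 1) * step k) \<le> real (card {p..<q})" by (rule of_nat_mono)
    moreover have "real (card T) \<le> 2 * real (card T - 1)" using False by simp
    then have "real (card T) * real (step k) \<le> 2 * real (card T - 1) * real (step k)"
      by (intro mult_right_mono) auto
    ultimately have "real (card T) * real (step k) \<le> 2 * real (card {p..<q})" by simp
    then have "real (card T) \<le> 2 * real (card {p..<q}) / real (step k)"
      using step_ge[OF k] l_pos by (simp add: field_simps)
    also have "\<dots> = 2 * n_seq (2 * k + 2) * \<mu> p q"
      using N_pos by (simp add: \<mu>_def N_eq[OF k] flip: real_n_nat)
    finally show ?thesis by (simp add: hT)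
  qed
qed

text \<open>A single point of \<open>A k\<close> in the interval makes \<open>h\<close> at least 1,
  and the summand of index \<open>k\<close> alone suffices.\<close>

lemma coefficient_le_\<Phi>:
  assumes "k < l" "r \<in> A k" "p \<le> r" "r < q"
  shows "c k \<le> \<Phi> p q"
proof -
  have "1 \<le> h k p q"
    using assms finite_A card_gt_0_iff[of "A k \<inter> {p..<q}"] by (auto simp: h_def Suc_le_eq)
  then have "1 \<le> h k p q powr (1 - \<delta> k)" using \<delta>_bounds[of k] by (intro ge_one_powr_ge_zero) auto
  then have "c k * 1 \<le> c k * h k p q powr (1 - \<delta> k)" using c_pos[of k] by (intro mult_left_mono) auto
  also have "\<dots> \<le> (\<Sum>k<l. c k * h k p q powr (1 - \<delta> k))"
    using assms(1) by (intro member_le_sum) (simp_all add: c_nonneg)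
  finally show ?thesis using \<mu>_nonneg[of p q] by (simp add: \<Phi>_def)
qed

lemma a_eq:
  assumes "k < l" "r \<in> A k"
  shows "a r = c k"
proof -
  have "r \<notin> A i" if "i < l" "i \<noteq> k" for i using A_disjoint[OF assms(1) that(1)] that(2) assms(2) by blast
  then show ?thesis using assms by (simp add: a_def sum.remove[of "{..<l}" k])
qed

lemma a_nonneg: "0 \<le> a r"
  unfolding a_def by (intro sum_nonneg) (simp add: c_nonneg)

lemma a_le_\<Phi>:
  assumes "p \<le> r" "r < q"
  shows "a r \<le> \<Phi> p q"
proof (cases "\<exists>k<l. r \<in> A k")
  case True
  then show ?thesis using a_eq coefficient_le_\<Phi>[OF _ _ assms] by auto
next
  case False
  then show ?thesis using \<Phi>_nonneg by (simp add: a_def)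
qed

text \<open>The choice of \<open>\<delta> k\<close> reduces the summand of index \<open>k\<close> to
  \<open>1 / m_seq (2 * k + 2) ^ 2\<close>. These sum to at most 1 for every \<open>l\<close>, and
  the \<open>\<mu>\<close> term adds 16.\<close>

lemma \<Phi>_total: "\<Phi> 0 N \<le> 17"
proof -
  have "c k * h k 0 N powr (1 - \<delta> k) \<le> (1 / 2) ^ Suc k" if k: "k < l" for k
  proof -
    let ?m = "real (m_seq (2 * k + 2))" and ?n = "n_seq (2 * k + 2)"
    have "A k \<inter> {0..<N} = A k" using A_less_N[OF k] by auto
    then have h: "h k 0 N = ?n" by (simp add: h_def card_A[OF k] real_n_nat)
    have n: "0 < ?n" using n_seq_ge_4[of "2 * k + 2"] by simp
    have m: "0 < ?m" using m_seq_pos[of "2 * k + 2"] by simp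
    have "?n = (15 * n_seq (2 * k + 1)) ^ (3 * 5 ^ (2 * k + 1))"
      using n_seq_Suc[of "2 * k + 1"] by simp
    also have "\<dots> = (15 * n_seq (2 * k + 1)) powr real (3 * 5 ^ (2 * k + 1))"
      using n_seq_ge_4[of "2 * k + 1"] by (intro powr_realpow[symmetric]) auto
    finally have "?n powr \<delta> k = ((15 * n_seq (2 * k + 1)) powr \<delta> k) powr real (3 * 5 ^ (2 * k + 1))"
      by (simp only: powr_powr mult.commute)
    also have "\<dots> = 2 ^ (3 * 5 ^ (2 * k + 1))" unfolding powr_\<delta> by (rule powr_realpow) simp
    also have "\<dots> = ?m ^ 3" using m_seq_eq[of "2 * k + 1"] by (simp flip: power_mult add: mult.commute)
    finally have "c k * h k 0 N powr (1 - \<delta> k) = ?m * ?n / (?n * ?m ^ 3)"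
      using n unfolding c_def h by (simp add: powr_diff)
    also have "\<dots> = 1 / ?m ^ 2" using n m by (simp add: field_simps power_numeral_reduce)
    also have "\<dots> \<le> 1 / ?m"
      using m_seq_ge_32[of "2 * k + 2"] m by (simp add: field_simps power2_eq_square)
    also have "\<dots> \<le> 1 / 2 ^ Suc k"
    proof (intro divide_left_mono)
      have "(2::nat) ^ Suc k \<le> 2 ^ (2 * k + 2)" by (intro power_increasing) auto
      also have "\<dots> \<le> m_seq (2 * k + 2)" by (rule m_seq_ge_2power) simp
      finally have "real (2 ^ Suc k) \<le> ?m" by (rule of_nat_mono)
      then show "2 ^ Suc k \<le> ?m" by simp
    qed (use m in auto)
    finally show ?thesis by (simp add: power_divide)
  qed
  then have "(\<Sum>k<l. c k * h k 0 N powr (1 - \<delta> k)) \<le> (\<Sum>k<l. (1 / 2) ^ Suc k)"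
    by (intro sum_mono) auto
  also have "(\<Sum>k<j. (1 / 2 :: real) ^ Suc k) = 1 - (1 / 2) ^ j" for j by (induction j) auto
  also have "1 - (1 / 2 :: real) ^ l \<le> 1" by simp
  finally show ?thesis using N_pos by (simp add: \<Phi>_def \<mu>_def)
qed

lemma sum_card_intervals_le:
  fixes X :: "nat set"
  assumes "finite S" "\<And>s. s \<in> S \<Longrightarrow> {p s..<q s} \<subseteq> {P..<Q}"
    and "\<And>s t. s \<in> S \<Longrightarrow> t \<in> S \<Longrightarrow> s \<noteq> t \<Longrightarrow> {p s..<q s} \<inter> {p t..<q t} = {}"
  shows "(\<Sum>s\<in>S. real (card (X \<inter> {p s..<q s}))) \<le> real (card (X \<inter> {P..<Q}))"
proof -
  have "(\<Sum>s\<in>S. card (X \<inter> {p s..<q s})) = card (\<Union>s\<in>S. X \<inter> {p s..<q s})"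
    using assms(1,3) by (intro card_UN_disjoint[symmetric]) (simp, simp, blast)
  also have "\<dots> \<le> card (X \<inter> {P..<Q})" using assms(2) by (intro card_mono) (simp, blast)
  finally show ?thesis by (simp flip: of_nat_sum)
qed

text \<open>The pieces of an interval, at most \<open>n_seq i\<close> in number, are paid for by
  half the weight \<open>m_seq i\<close>. The summands of \<open>\<Phi>\<close> with
  \<open>2 * k + 2\<close> above \<open>i\<close> lose only a factor 2 by Jensen's inequality; the
  others are bounded additively, and equidistribution moves any excess into the \<open>\<mu>\<close>
  term.\<close>

lemma sum_\<Phi>_le:
  assumes i: "2 \<le> i" and S: "finite S" "real (card S) \<le> n_seq i"
    and sub: "\<And>s. s \<in> S \<Longrightarrow> {p s..<q s} \<subseteq> {P..<Q}"
    and disj: "\<And>s t. s \<in> S \<Longrightarrow> t \<in> S \<Longrightarrow> s \<noteq> t \<Longrightarrow> {p s..<q s} \<inter> {p t..<q t} = {}"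
  shows "(\<Sum>s\<in>S. \<Phi> (p s) (q s)) \<le> real (m_seq i) / 2 * \<Phi> P Q"
proof -
  let ?m = "real (m_seq i)"
  have m: "32 \<le> ?m" using m_seq_ge_32[OF i] by linarith
  have \<mu>: "(\<Sum>s\<in>S. \<mu> (p s) (q s)) \<le> \<mu> P Q"
    using sum_card_intervals_le[OF S(1) sub disj, where X = UNIV]
    by (simp add: \<mu>_def divide_right_mono flip: sum_divide_distrib)
  have h: "(\<Sum>s\<in>S. h k (p s) (q s)) \<le> h k P Q" for k
    unfolding h_def by (rule sum_card_intervals_le[OF S(1) sub disj])
  \<comment> \<open>The multiple of \<open>\<mu> P Q\<close> that the summand of index
    \<open>k\<close> may cost:
    \<open>c k * (2 * n_seq (2 * k + 2)) = 2 * m_seq (2 * k + 2)\<close>.\<close>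
  let ?b = "\<lambda>k. if 2 * k + 2 \<le> i then 2 * real (m_seq (2 * k + 2)) else 0"
  have summand: "(\<Sum>s\<in>S. c k * h k (p s) (q s) powr (1 - \<delta> k)) \<le> 2 * (c k * h k P Q powr (1 - \<delta> k)) + ?b k * \<mu> P Q"
    if k: "k < l" for k
  proof (cases "2 * k + 2 \<le> i")
    case True
    \<comment> \<open>As a cardinality, \<open>h\<close> is either 0 or at least 1, so lowering the
      exponent from 1 to \<open>1 - \<delta> k\<close> cannot increase the power.\<close>
    have *: "h k p q powr (1 - \<delta> k) \<le> h k p q" for p q
    proof (cases "h k p q = 0")
      case False
      then have "1 \<le> h k p q" by (simp add: h_def Suc_le_eq card_gt_0_iff)
      then have "h k p q powr (1 - \<delta> k) \<le> h k p q powr 1"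
        using \<delta>_bounds[of k] by (intro powr_mono) auto
      then show ?thesis using h_nonneg by simp
    qed simp
    have "(\<Sum>s\<in>S. c k * h k (p s) (q s) powr (1 - \<delta> k)) \<le> (\<Sum>s\<in>S. c k * h k (p s) (q s))"
      using * c_pos[of k] by (intro sum_mono mult_left_mono) auto
    also have "\<dots> \<le> c k * h k P Q"
      using h[of k] c_pos[of k] by (simp flip: sum_distrib_left)
    also have "\<dots> \<le> 2 * (c k * h k P Q powr (1 - \<delta> k)) + ?b k * \<mu> P Q"
    proof (cases "h k P Q \<le> 1")
      case 1: True
      then have "h k P Q = 0 \<or> h k P Q = 1" by (auto simp: h_def le_Suc_eq)
      then have "h k P Q powr (1 - \<delta> k) = h k P Q" by auto
      then show ?thesis using True c_pos[of k] h_nonneg[of k P Q] \<mu>_nonneg[of P Q] by simp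
    next
      case 2: False
      then have "h k P Q \<le> 2 * n_seq (2 * k + 2) * \<mu> P Q" using h_le[OF k] by blast
      then have "c k * h k P Q \<le> c k * (2 * n_seq (2 * k + 2) * \<mu> P Q)"
        using c_pos[of k] by (intro mult_left_mono) auto
      also have "\<dots> = ?b k * \<mu> P Q" using True n_seq_ge_4[of "2 * k + 2"] by (simp add: c_def)
      finally show ?thesis using c_pos[of k] by (smt (verit) mult_nonneg_nonneg powr_ge_zero)
    qed
    finally show ?thesis .
  next
    case False
    \<comment> \<open>Now \<open>i \<le> 2 * k + 1\<close>, so the number of pieces is at most
      \<open>15 * n_seq (2 * k + 1)\<close>, whose power \<open>\<delta> k\<close> is 2.\<close>
    have "(\<Sum>s\<in>S. c k * h k (p s) (q s) powr (1 - \<delta> k)) = c k * (\<Sum>s\<in>S. h k (p s) (q s) powr (1 - \<delta> k))"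
      by (simp add: sum_distrib_left)
    also have "\<dots> \<le> c k * (2 * h k P Q powr (1 - \<delta> k))"
    proof (intro mult_left_mono)
      have "n_seq i \<le> n_seq (2 * k + 1)" using False i by (intro n_seq_mono) auto
      then have "real (card S) \<le> 15 * n_seq (2 * k + 1)"
        using S(2) n_seq_ge_4[of "2 * k + 1"] by simp
      then have "(\<Sum>s\<in>S. h k (p s) (q s) powr (1 - \<delta> k))
          \<le> 2 * (\<Sum>s\<in>S. h k (p s) (q s)) powr (1 - \<delta> k)"
        using sum_powr_le[OF S(1), of "\<lambda>s. h k (p s) (q s)" "\<delta> k" "15 * n_seq (2 * k + 1)"]
          \<delta>_bounds[of k] h_nonneg powr_\<delta>[of k] by simp
      also have "\<dots> \<le> 2 * h k P Q powr (1 - \<delta> k)"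
        using h[of k] \<delta>_bounds[of k] h_nonneg by (intro mult_left_mono powr_mono2 sum_nonneg) auto
      finally show "(\<Sum>s\<in>S. h k (p s) (q s) powr (1 - \<delta> k)) \<le> 2 * h k P Q powr (1 - \<delta> k)" .
    qed (use c_pos[of k] in simp)
    finally show ?thesis using False by simp
  qed
  have b: "(\<Sum>k<l. ?b k) \<le> 4 * ?m"
  proof -
    have "(\<Sum>k<l. ?b k) = (\<Sum>k\<in>{k. k < l \<and> 2 * k + 2 \<le> i}. 2 * real (m_seq (2 * k + 2)))"
      by (subst sum.inter_filter[symmetric]) (auto intro: sum.cong)
    also have "\<dots> = (\<Sum>j\<in>(\<lambda>k. 2 * k + 2) ` {k. k < l \<and> 2 * k + 2 \<le> i}. 2 * real (m_seq j))"
      by (subst sum.reindex) (auto simp: inj_on_def)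
    also have "\<dots> \<le> (\<Sum>j\<in>{1..i}. 2 * real (m_seq j))" by (intro sum_mono2) auto
    also have "\<dots> \<le> 4 * ?m" using sum_m_seq_le[of i] i by (simp flip: sum_distrib_left)
    finally show ?thesis .
  qed
  let ?h = "\<Sum>k<l. c k * h k P Q powr (1 - \<delta> k)"
  have "(\<Sum>s\<in>S. \<Phi> (p s) (q s)) = 16 * (\<Sum>s\<in>S. \<mu> (p s) (q s)) + (\<Sum>k<l. \<Sum>s\<in>S. c k * h k (p s) (q s) powr (1 - \<delta> k))"
    unfolding \<Phi>_def sum.distrib sum_distrib_left by (subst (2) sum.swap) simp
  also have "\<dots> \<le> 16 * \<mu> P Q + (\<Sum>k<l. 2 * (c k * h k P Q powr (1 - \<delta> k)) + ?b k * \<mu> P Q)"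
    using \<mu> summand by (intro add_mono sum_mono) auto
  also have "\<dots> = 16 * \<mu> P Q + 2 * ?h + (\<Sum>k<l. ?b k) * \<mu> P Q"
    by (simp add: sum.distrib sum_distrib_left sum_distrib_right)
  also have "\<dots> \<le> 16 * \<mu> P Q + 2 * ?h + 4 * ?m * \<mu> P Q"
    using b \<mu>_nonneg[of P Q] by (intro add_mono mult_right_mono order_refl) auto
  also have "\<dots> = (16 + 4 * ?m) * \<mu> P Q + 2 * ?h" by (simp add: algebra_simps)
  \<comment> \<open>The constants close up because \<open>32 \<le> ?m\<close>: both
    \<open>16 + 4 * ?m \<le> 8 * ?m\<close> and \<open>2 \<le> ?m / 2\<close> hold, and
    \<open>8 * ?m\<close> is \<open>?m / 2\<close> times the weight 16 of \<open>\<mu>\<close> in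
    \<open>\<Phi>\<close>.\<close>
  also have "\<dots> \<le> (8 * ?m) * \<mu> P Q + ?m / 2 * ?h"
    using m \<mu>_nonneg c_pos by (intro add_mono mult_right_mono sum_nonneg) (simp_all add: c_nonneg)
  also have "\<dots> = ?m / 2 * \<Phi> P Q" by (simp add: \<Phi>_def algebra_simps)
  finally show ?thesis .
qed

end

subsection \<open>Rapidly increasing sequences\<close>

context X4_completion
begin

lemma ap_add_le: "ap f (v + w) \<le> ap f v + ap f w"
  using ap_sum_le[of f "\<lambda>b. if b then v else w" "{True, False}"] by (simp add: add.commute)

lemma ap_le_sum_coord:
  assumes "\<And>n. \<bar>f n\<bar> \<le> B" "0 \<le> B" "f \<in> c00" "finite (cs w)"
  shows "ap f w \<le> B * (\<Sum>n\<in>cs w. \<bar>coord n w\<bar>)"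
proof -
  have "ap f w = (\<Sum>n\<in>supp f \<union> cs w. \<bar>f n\<bar> * \<bar>coord n w\<bar>)"
    using assms(3,4) by (intro ap_superset) (auto simp: c00_def)
  also have "\<dots> = (\<Sum>n\<in>cs w. \<bar>f n\<bar> * \<bar>coord n w\<bar>)"
    using assms(3,4) by (intro sum.mono_neutral_right) (auto simp: c00_def cs_def)
  also have "\<dots> \<le> B * (\<Sum>n\<in>cs w. \<bar>coord n w\<bar>)"
    unfolding sum_distrib_left using assms(1) by (intro sum_mono mult_right_mono) auto
  finally show ?thesis .
qed

text \<open>A rapidly increasing sequence, tuned to sums of at most \<open>N\<close> of its members.\<close>

definition ris :: "nat \<Rightarrow> nat \<Rightarrow> (nat \<Rightarrow> 'a) \<Rightarrow> bool" where
  "ris N i0 z \<longleftrightarrow>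
    (\<forall>r. finite (cs (z r)) \<and> 1 \<le> norm (z r) \<and> norm (z r) \<le> 2) \<and>
    (\<forall>r r'. r < r' \<longrightarrow> sep (<) (z r) (z r')) \<and>
    (\<forall>i fs r. 2 \<le> i \<and> i < i0 \<and> block_seq fs \<and> real (length fs) \<le> n_seq i \<and> (\<forall>f\<in>set fs. W f) \<longrightarrow>
      (\<Sum>s<length fs. ap (fs ! s) (z r)) \<le> 4) \<and>
    (\<forall>i fs. i0 \<le> i \<and> block_seq fs \<and> real (length fs) \<le> n_seq i \<and> (\<forall>f\<in>set fs. W f) \<longrightarrow>
      (\<exists>r0. \<forall>r. r \<noteq> r0 \<longrightarrow> ap (op_result (1 / real (m_seq i)) fs) (z r) \<le> 4 / real N))"

text \<open>Choose averages \<open>z r\<close> of order \<open>i r\<close> greedily, with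
  \<open>m_seq (i (Suc r))\<close> beyond \<open>N\<close> times the \<open>l\<^sub>1\<close>-norm
  of \<open>z r\<close>. A functional of weight index \<open>j\<close> is small on later vectors by
  averaging and on earlier ones because its coordinates are at most \<open>1 / m_seq j\<close>; only
  the \<open>r\<close> with \<open>i r \<le> j < i (Suc r)\<close> can be exceptional.\<close>

lemma exists_ris:
  assumes u: "blocks u" and N: "0 < N"
  obtains i0 z where "ris N i0 z" "\<And>r. z r \<in> span (range u)"
proof -
  define avg where "avg i z \<longleftrightarrow> (\<forall>i' fs. 2 \<le> i' \<and> i' < i \<and> block_seq fs \<and> real (length fs) \<le> n_seq i' \<and>
    (\<forall>f\<in>set fs. W f) \<longrightarrow> (\<Sum>s<length fs. ap (fs ! s) z) \<le> 4)" for i z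
  \<comment> \<open>In a triple \<open>(z, i, K)\<close>, \<open>i\<close> is the order of averaging
    and \<open>K\<close> bounds the support of \<open>z\<close> from the left. \<open>Q\<close>
    imposes the growth from one triple to the next.\<close>
  define P where "P = (\<lambda>(z, i, K). z \<in> span (range u) \<and> finite (cs z) \<and> cs z \<subseteq> {K<..} \<and>
    1 \<le> norm z \<and> norm z \<le> 2 \<and> (2::nat) \<le> i \<and> real N \<le> real (m_seq i) \<and> avg i z)"
  define Q where "Q = (\<lambda>(z, i, K) (z' :: 'a, i', K'). i \<le> i' \<and> (K::nat) \<le> K' \<and> cs z \<subseteq> {..K'} \<and>
    real N * (\<Sum>n\<in>cs z. \<bar>coord n z\<bar>) \<le> real (m_seq i'))"
  have avg: "\<exists>z. P (z, i, K)" if i: "2 \<le> i" "real N \<le> real (m_seq i)" for i K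
  proof -
    have n: "1 \<le> n_nat i" using n_seq_ge_4[of i] i by (simp flip: real_n_nat)
    obtain z where z: "z \<in> span (range u)" "finite (cs z)" "cs z \<subseteq> {K<..}" "1 \<le> norm z" "norm z \<le> 2"
      "\<forall>fs. block_seq fs \<and> (\<forall>f\<in>set fs. W f) \<and> length fs \<le> n_nat i \<longrightarrow> (\<Sum>s<length fs. ap (fs ! s) z) \<le> 4"
      by (rule l1_average[OF u n])
    have "length fs \<le> n_nat i" if "2 \<le> i'" "i' < i" "real (length fs) \<le> n_seq i'" for fs :: "vec list" and i'
    proof -
      have "real (length fs) \<le> real (n_nat i)" using that n_seq_mono[of i' i] unfolding real_n_nat by simp
      then show ?thesis by (simp only: of_nat_le_iff)
    qed
    then have "avg i z" unfolding avg_def using z(6) by blast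
    then show ?thesis using z(1-5) i by (auto simp: P_def)
  qed
  have "\<exists>f. \<forall>r. P (f r) \<and> Q (f r) (f (Suc r))"
  proof (rule dependent_nat_choice)
    obtain i where "i \<ge> 2" "real N \<le> real (m_seq i)" using m_seq_unbounded by blast
    then show "\<exists>x. P x" using avg[of i 0] by blast
  next
    fix x r assume "P x"
    obtain z i K where x: "x = (z, i, K)" by (cases x)
    let ?S = "\<Sum>n\<in>cs z. \<bar>coord n z\<bar>"
    obtain i1 where i1: "i1 \<ge> 2" "real N * ?S \<le> real (m_seq i1)" using m_seq_unbounded by blast
    define i' where "i' = max i i1"
    define K' where "K' = max K (Max (cs z))"
    have P: "finite (cs z)" "2 \<le> i" "real N \<le> real (m_seq i)" using \<open>P x\<close> by (auto simp: x P_def)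
    have "m_seq i \<le> m_seq i'" "m_seq i1 \<le> m_seq i'"
      using P(2) i1(1) by (auto simp: i'_def intro!: m_seq_mono)
    then have "real N \<le> real (m_seq i')" "real N * ?S \<le> real (m_seq i')" "2 \<le> i'"
      using P i1 by (auto simp: i'_def)
    moreover from this obtain z' where "P (z', i', K')" using avg[of i' K'] by blast
    moreover have "cs z \<subseteq> {..K'}" using P(1) by (auto simp: K'_def le_max_iff_disj)
    ultimately have "P (z', i', K') \<and> Q x (z', i', K')"
      by (auto simp: x Q_def i'_def K'_def)
    then show "\<exists>y. P y \<and> Q x y" by blast
  qed
  then obtain F where F: "\<And>r. P (F r)" "\<And>r. Q (F r) (F (Suc r))" by blast
  define z i K where "z = (\<lambda>r. fst (F r))" and "i = (\<lambda>r. fst (snd (F r)))" and "K = (\<lambda>r. snd (snd (F r)))"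
  have F_eq: "F r = (z r, i r, K r)" for r by (simp add: z_def i_def K_def)
  have z: "z r \<in> span (range u)" "finite (cs (z r))" "cs (z r) \<subseteq> {K r<..}" "1 \<le> norm (z r)" "norm (z r) \<le> 2"
    "2 \<le> i r" "real N \<le> real (m_seq (i r))" "avg (i r) (z r)" for r
    using F(1)[of r] by (simp_all add: F_eq P_def)
  have Q: "i r \<le> i (Suc r)" "K r \<le> K (Suc r)" "cs (z r) \<subseteq> {..K (Suc r)}"
    "real N * (\<Sum>n\<in>cs (z r). \<bar>coord n (z r)\<bar>) \<le> real (m_seq (i (Suc r)))" for r
    using F(2)[of r] by (simp_all add: F_eq Q_def)
  have mono: "i r \<le> i r'" "K r \<le> K r'" if "r \<le> r'" for r r'
    using Q(1,2) that by (auto intro: lift_Suc_mono_le)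
  have sep_z: "sep (<) (z r) (z r')" if "r < r'" for r r'
    unfolding sep_def
  proof (intro ballI)
    fix n n' assume "n \<in> cs (z r)" "n' \<in> cs (z r')"
    then have "n \<le> K (Suc r)" "K r' < n'" using Q(3)[of r] z(3)[of r'] by auto
    then show "n < n'" using mono(2)[of "Suc r" r'] that by linarith
  qed
  have avg_z: "(\<Sum>s<length fs. ap (fs ! s) (z r)) \<le> 4"
    if "2 \<le> j" "j < i 0" "block_seq fs" "real (length fs) \<le> n_seq j" "\<forall>f\<in>set fs. W f" for j fs r
    using z(8)[of r] mono(1)[of 0 r] that unfolding avg_def by (meson le0 less_le_trans)
  have single: "\<exists>r0. \<forall>r. r \<noteq> r0 \<longrightarrow> ap (op_result (1 / real (m_seq j)) fs) (z r) \<le> 4 / real N"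
    if j: "i 0 \<le> j" and fs: "block_seq fs" "real (length fs) \<le> n_seq j" "\<forall>f\<in>set fs. W f" for j fs
  proof -
    let ?f = "op_result (1 / real (m_seq j)) fs"
    have j2: "2 \<le> j" using z(6)[of 0] j by simp
    have "m_seq (i 0) \<le> m_seq j" using z(6)[of 0] j by (intro m_seq_mono) auto
    then have mN: "real N \<le> real (m_seq j)" using z(7)[of 0] by linarith
    have m: "0 < real (m_seq j)" using m_seq_pos[of j] j2 by simp
    have low: "ap ?f (z r) \<le> 4 / real N" if "j < i r" for r
    proof -
      have "ap ?f (z r) \<le> 1 / real (m_seq j) * (\<Sum>s<length fs. ap (fs ! s) (z r))"
        by (rule ap_op_result_le[OF fs(1)]) simp
      also have "\<dots> \<le> 1 / real (m_seq j) * 4"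
        using z(8)[of r] fs j2 that unfolding avg_def by (intro mult_left_mono) auto
      also have "\<dots> \<le> 4 / real N" using mN N by (simp add: frac_le)
      finally show ?thesis .
    qed
    have high: "ap ?f (z r) \<le> 4 / real N" if "i (Suc r) \<le> j" for r
    proof -
      have "\<bar>?f n\<bar> \<le> 1 / real (m_seq j)" for n
        using fs W4_bounded by (intro op_result_bounded) auto
      then have "ap ?f (z r) \<le> 1 / real (m_seq j) * (\<Sum>n\<in>cs (z r). \<bar>coord n (z r)\<bar>)"
        using op_result_c00[OF fs(1)] z(2) by (intro ap_le_sum_coord) auto
      also have "\<dots> \<le> 1 / real N"
      proof -
        have "m_seq (i (Suc r)) \<le> m_seq j" using that z(6)[of "Suc r"] by (intro m_seq_mono) auto
        then have "real N * (\<Sum>n\<in>cs (z r). \<bar>coord n (z r)\<bar>) \<le> real (m_seq j)" using Q(4)[of r] by linarith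
        then show ?thesis using m N by (simp add: field_simps)
      qed
      also have "\<dots> \<le> 4 / real N" by (simp add: divide_right_mono)
      finally show ?thesis .
    qed
    show ?thesis
    proof (cases "\<exists>r. i r \<le> j \<and> j < i (Suc r)")
      case True
      then obtain r0 where r0: "i r0 \<le> j" "j < i (Suc r0)" by blast
      have "ap ?f (z r) \<le> 4 / real N" if "r \<noteq> r0" for r
      proof (cases "r < r0")
        case True
        then show ?thesis using r0(1) mono(1)[of "Suc r" r0] by (intro high) simp
      next
        case False
        then show ?thesis using that r0(2) mono(1)[of "Suc r0" r] by (intro low) simp
      qed
      then show ?thesis by blast
    next
      case False
      then have "ap ?f (z r) \<le> 4 / real N" for r using low[of r] high[of r] by (meson not_le)
      then show ?thesis by blast
    qed
  qed
  have "ris N (i 0) z"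
    unfolding ris_def
  proof (intro conjI)
    show "\<forall>r. finite (cs (z r)) \<and> 1 \<le> norm (z r) \<and> norm (z r) \<le> 2" using z(2,4,5) by simp
    show "\<forall>r r'. r < r' \<longrightarrow> sep (<) (z r) (z r')" using sep_z by blast
  qed (intro allI impI, elim conjE, rule avg_z single; assumption)+
  then show thesis using z(1) by (rule that)
qed

text \<open>Induction over the functional, for all intervals of indices at once. For small weights
  the action is distributed to subintervals, where the supersolution property of
  \<open>\<Phi>\<close> applies; for large weights all but one of the blocks are negligible.\<close>

lemma ris_sum_interval_le:
  assumes z: "ris (interlacing.N l) i0 z" and l: "1 \<le> l" and f: "W f" and q: "q \<le> interlacing.N l"
  shows "ap f (\<Sum>r\<in>{p..<q}. interlacing.a l r *\<^sub>R z r) \<le> 8 * interlacing.\<Phi> l p q"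
proof -
  interpret interlacing l using l by unfold_locales
  define X where "X p q = (\<Sum>r\<in>{p..<q}. a r *\<^sub>R z r)" for p q
  have sep_z: "sep (<) (z r) (z r')" if "r < r'" for r r' using z that by (simp add: ris_def)
  have norm_z: "norm (z r) \<le> 2" for r using z by (simp add: ris_def)
  have X_le: "ap f (X p q) \<le> (\<Sum>r\<in>{p..<q}. a r * ap f (z r))" for f p q
    unfolding X_def using ap_sum_le[of f "\<lambda>r. a r *\<^sub>R z r" "{p..<q}"] by (simp add: ap_scale a_nonneg)
  have "\<forall>p q. q \<le> N \<longrightarrow> ap f (X p q) \<le> 8 * \<Phi> p q"
    using f
  proof (induction rule: W4_modulus_induct)
    case (unit n)
    show ?case
    proof (intro allI impI)
      fix p q
      have le: "a r * ap (unit_vec n) (z r) \<le> 8 * \<Phi> p q" if "r \<in> {p..<q}" for r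
      proof -
        have "a r * ap (unit_vec n) (z r) \<le> \<Phi> p q * 2"
          using a_le_\<Phi>[of p r q] that a_nonneg norm_z[of r] abs_coord_le[of n "z r"] \<Phi>_nonneg
          by (intro mult_mono) (auto simp: ap_unit_vec)
        then show ?thesis using \<Phi>_nonneg[of p q] by linarith
      qed
      have "ap (unit_vec n) (X p q) \<le> (\<Sum>r\<in>{p..<q}. a r * ap (unit_vec n) (z r))" by (rule X_le)
      also have "\<dots> \<le> 8 * \<Phi> p q"
      proof (cases "\<exists>r\<in>{p..<q}. n \<in> cs (z r)")
        case True
        then obtain r0 where r0: "r0 \<in> {p..<q}" "n \<in> cs (z r0)" by blast
        have "ap (unit_vec n) (z r) = 0" if "r \<noteq> r0" for r
        proof -
          have "n \<notin> cs (z r)"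
            using sepD[OF sep_z[of r r0], of n n] sepD[OF sep_z[of r0 r], of n n] r0(2) that
            by (cases "r < r0") auto
          then show ?thesis by (simp add: ap_unit_vec cs_def)
        qed
        then have "(\<Sum>r\<in>{p..<q}. a r * ap (unit_vec n) (z r)) = a r0 * ap (unit_vec n) (z r0)"
          using r0(1) by (simp add: sum.remove[of _ r0])
        then show ?thesis using le[OF r0(1)] by simp
      next
        case False
        then have "(\<Sum>r\<in>{p..<q}. a r * ap (unit_vec n) (z r)) = 0"
          by (intro sum.neutral) (auto simp: ap_unit_vec cs_def)
        then show ?thesis using \<Phi>_nonneg[of p q] by linarith
      qed
      finally show "ap (unit_vec n) (X p q) \<le> 8 * \<Phi> p q" .
    qed
  next
    case (mono f g)
    then show ?case using ap_mono[of f g] by (meson order_trans)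
  next
    case (op i fs)
    let ?m = "real (m_seq i)" and ?f = "op_result (1 / real (m_seq i)) fs"
    have m: "0 < ?m" using m_seq_pos[of i] op(1) by simp
    have fs: "\<forall>f\<in>set fs. W f" using op(5) by blast
    have IH: "ap (fs ! s) (X p q) \<le> 8 * \<Phi> p q" if "s < length fs" "q \<le> N" for s p q
      using op(5)[of "fs ! s"] that by simp
    show ?case
    proof (intro allI impI)
      fix p q assume q: "q \<le> N"
      show "ap ?f (X p q) \<le> 8 * \<Phi> p q"
      proof (cases "i < i0")
        case True
        then have avg: "(\<Sum>s<length fs. ap (fs ! s) (z r)) \<le> 4" for r
          using z op(1-3) fs unfolding ris_def by blast
        \<comment> \<open>\<open>R s\<close> collects the blocks in the range that are met by the
          functional \<open>fs ! s\<close>, and \<open>S\<close> the functionals that meet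
          any.\<close>
        define R where "R s = {r \<in> {p..<q}. supp (fs ! s) \<inter> cs (z r) \<noteq> {}}" for s
        define S where "S = {s \<in> {..<length fs}. R s \<noteq> {}}"
        have finR: "finite (R s)" for s by (simp add: R_def)
        have finS: "finite S" by (simp add: S_def)
        have MinMax: "Min (R s) \<in> R s" "Max (R s) \<in> R s" if "s \<in> S" for s
          using that finR by (auto simp: S_def)
        have R_sub: "R s \<subseteq> {p..<q}" for s by (auto simp: R_def)
        have hits: "r \<le> r'" if "s < t" "t < length fs" "r \<in> R s" "r' \<in> R t" for s t r r'
          using hits_mono[OF op(2), of UNIV z s t r r'] sep_z that by (auto simp: R_def)
        have cardS: "card S \<le> length fs"
          using card_mono[of "{..<length fs}" S] by (auto simp: S_def)
        text \<open>Among the blocks met by \<open>fs ! s\<close> the first one is split off, which makes the remaining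
          intervals disjoint.\<close>
        have split: "ap (fs ! s) (X p q) \<le> a (Min (R s)) * ap (fs ! s) (z (Min (R s)))
            + 8 * \<Phi> (Suc (Min (R s))) (Suc (Max (R s)))" if s: "s \<in> S" for s
        proof -
          let ?a = "Min (R s)" and ?b = "Max (R s)"
          have ab: "?a \<in> {p..<q}" "?b \<in> {p..<q}" "?a \<le> ?b"
            using MinMax[OF s] R_sub[of s] finR[of s] by auto
          define T where "T = {p..<q} - {?a} - {Suc ?a..<Suc ?b}"
          have "X p q = a ?a *\<^sub>R z ?a + (\<Sum>r\<in>{p..<q} - {?a}. a r *\<^sub>R z r)"
            unfolding X_def using ab(1) by (intro sum.remove) auto
          also have "(\<Sum>r\<in>{p..<q} - {?a}. a r *\<^sub>R z r) = (\<Sum>r\<in>T. a r *\<^sub>R z r) + X (Suc ?a) (Suc ?b)"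
            unfolding X_def T_def using ab by (intro sum.subset_diff) auto
          finally have "ap (fs ! s) (X p q) \<le> ap (fs ! s) (a ?a *\<^sub>R z ?a)
              + (ap (fs ! s) (\<Sum>r\<in>T. a r *\<^sub>R z r) + ap (fs ! s) (X (Suc ?a) (Suc ?b)))"
            using ap_add_le by (smt (verit))
          moreover have "ap (fs ! s) (\<Sum>r\<in>T. a r *\<^sub>R z r) \<le> (\<Sum>r\<in>T. a r * ap (fs ! s) (z r))"
            using ap_sum_le[of "fs ! s" "\<lambda>r. a r *\<^sub>R z r" T] by (simp add: ap_scale a_nonneg)
          moreover have "(\<Sum>r\<in>T. a r * ap (fs ! s) (z r)) = 0"
          proof (rule sum.neutral, rule ballI)
            fix r assume r: "r \<in> T"
            have "r \<notin> R s"
            proof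
              assume "r \<in> R s"
              then have "?a \<le> r" "r \<le> ?b" using finR by auto
              then show False using r by (auto simp: T_def)
            qed
            then have "supp (fs ! s) \<inter> cs (z r) = {}" using r by (auto simp: R_def T_def)
            then show "a r * ap (fs ! s) (z r) = 0" by (simp add: ap_eq_0)
          qed
          moreover have "ap (fs ! s) (X (Suc ?a) (Suc ?b)) \<le> 8 * \<Phi> (Suc ?a) (Suc ?b)"
            using s ab(2) q by (intro IH) (auto simp: S_def)
          ultimately show ?thesis by (simp add: ap_scale a_nonneg)
        qed
        \<comment> \<open>Several functionals may share the same first block \<open>r\<close>, so
          they are grouped by \<open>r\<close>. Together they contribute at most
          \<open>4 * a r\<close> by the averaging property, and the singletons
          \<open>{r..<Suc r}\<close> are disjoint intervals for
          \<open>sum_\<Phi>_le\<close>.\<close>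
        have first: "(\<Sum>s\<in>S. a (Min (R s)) * ap (fs ! s) (z (Min (R s)))) \<le> 4 * (?m / 2 * \<Phi> p q)"
        proof -
          let ?M = "(\<lambda>s. Min (R s)) ` S"
          have "(\<Sum>s\<in>S. a (Min (R s)) * ap (fs ! s) (z (Min (R s))))
              = (\<Sum>r\<in>?M. \<Sum>s\<in>{s \<in> S. Min (R s) = r}. a (Min (R s)) * ap (fs ! s) (z (Min (R s))))"
            by (rule sum.image_gen[OF finS])
          also have "\<dots> \<le> (\<Sum>r\<in>?M. 4 * \<Phi> r (Suc r))"
          proof (rule sum_mono)
            fix r
            have "(\<Sum>s\<in>{s \<in> S. Min (R s) = r}. a (Min (R s)) * ap (fs ! s) (z (Min (R s))))
                = a r * (\<Sum>s\<in>{s \<in> S. Min (R s) = r}. ap (fs ! s) (z r))"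
              by (simp add: sum_distrib_left)
            also have "\<dots> \<le> a r * (\<Sum>s<length fs. ap (fs ! s) (z r))"
              using a_nonneg ap_nonneg by (intro mult_left_mono sum_mono2) (auto simp: S_def)
            also have "\<dots> \<le> \<Phi> r (Suc r) * 4"
              using avg a_le_\<Phi>[of r r "Suc r"] \<Phi>_nonneg ap_nonneg by (intro mult_mono sum_nonneg) auto
            finally show "(\<Sum>s\<in>{s \<in> S. Min (R s) = r}. a (Min (R s)) * ap (fs ! s) (z (Min (R s))))
                \<le> 4 * \<Phi> r (Suc r)" by simp
          qed
          also have "\<dots> = 4 * (\<Sum>r\<in>?M. \<Phi> r (Suc r))" by (simp add: sum_distrib_left)
          also have "(\<Sum>r\<in>?M. \<Phi> r (Suc r)) \<le> ?m / 2 * \<Phi> p q"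
          proof (rule sum_\<Phi>_le[OF op(1)])
            have "card ?M \<le> length fs" using card_image_le[OF finS, of "\<lambda>s. Min (R s)"] cardS by linarith
            then show "real (card ?M) \<le> n_seq i" using op(3) by linarith
            show "{r..<Suc r} \<subseteq> {p..<q}" if "r \<in> ?M" for r
              using that MinMax(1) R_sub by fastforce
          qed (use finS in auto)
          finally show ?thesis by simp
        qed
        \<comment> \<open>By \<open>hits\<close>, the last block met by a functional does not come
          after the first block met by a later one. Starting just behind the first block therefore
          makes these intervals disjoint.\<close>
        have rest: "(\<Sum>s\<in>S. \<Phi> (Suc (Min (R s))) (Suc (Max (R s)))) \<le> ?m / 2 * \<Phi> p q"
        proof (rule sum_\<Phi>_le[OF op(1) finS])
          show "real (card S) \<le> n_seq i" using cardS op(3) by linarith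
          show "{Suc (Min (R s))..<Suc (Max (R s))} \<subseteq> {p..<q}" if "s \<in> S" for s
            using MinMax[OF that] R_sub[of s] by fastforce
          have *: "{Suc (Min (R s))..<Suc (Max (R s))} \<inter> {Suc (Min (R t))..<Suc (Max (R t))} = {}"
            if "s \<in> S" "t \<in> S" "s < t" for s t
            using hits[OF that(3) _ MinMax(2)[OF that(1)] MinMax(1)[OF that(2)]] that(2)
            by (auto simp: S_def)
          show "{Suc (Min (R s))..<Suc (Max (R s))} \<inter> {Suc (Min (R t))..<Suc (Max (R t))} = {}"
            if "s \<in> S" "t \<in> S" "s \<noteq> t" for s t
            using *[of s t] *[of t s] that by (cases "s < t") auto
        qed
        have "ap ?f (X p q) \<le> 1 / ?m * (\<Sum>s<length fs. ap (fs ! s) (X p q))"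
          by (rule ap_op_result_le[OF op(2)]) simp
        also have "(\<Sum>s<length fs. ap (fs ! s) (X p q)) = (\<Sum>s\<in>S. ap (fs ! s) (X p q))"
        proof (rule sum.mono_neutral_right)
          show "\<forall>s\<in>{..<length fs} - S. ap (fs ! s) (X p q) = 0"
          proof
            fix s assume "s \<in> {..<length fs} - S"
            then have "R s = {}" by (simp add: S_def)
            then have "(\<Sum>r\<in>{p..<q}. a r * ap (fs ! s) (z r)) = 0"
              by (intro sum.neutral) (auto simp: R_def ap_eq_0)
            then show "ap (fs ! s) (X p q) = 0" using X_le[of "fs ! s" p q] ap_nonneg[of "fs ! s" "X p q"] by linarith
          qed
        qed (auto simp: S_def)
        also have "1 / ?m * (\<Sum>s\<in>S. ap (fs ! s) (X p q)) \<le> 1 / ?m * (\<Sum>s\<in>S. a (Min (R s)) * ap (fs ! s) (z (Min (R s)))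
            + 8 * \<Phi> (Suc (Min (R s))) (Suc (Max (R s))))"
          using split by (intro mult_left_mono sum_mono) auto
        also have "\<dots> \<le> 1 / ?m * (4 * (?m / 2 * \<Phi> p q) + 8 * (?m / 2 * \<Phi> p q))"
          unfolding sum.distrib sum_distrib_left[symmetric]
          using first rest by (intro mult_left_mono add_mono) auto
        also have "\<dots> = 6 * \<Phi> p q" using m by simp
        finally show ?thesis using \<Phi>_nonneg[of p q] by linarith
      next
        case False
        then obtain r0 where r0: "\<And>r. r \<noteq> r0 \<Longrightarrow> ap ?f (z r) \<le> 4 / real N"
          using z op(2,3) fs unfolding ris_def by (meson not_le)
        \<comment> \<open>The exceptional block \<open>r0\<close> contributes at most its norm 2,
          and the remaining ones, fewer than or equal to \<open>N\<close> in number, at most 4 in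
          total.\<close>
        have "a r * ap ?f (z r) \<le> \<Phi> p q * ((if r = r0 then 2 else 0) + 4 / real N)" if "r \<in> {p..<q}" for r
        proof (rule mult_mono)
          have "ap ?f (z r0) \<le> 2" using ap_le_norm[OF op(4), of "z r0"] norm_z[of r0] by linarith
          then show "ap ?f (z r) \<le> (if r = r0 then 2 else 0) + 4 / real N"
            using r0[of r] by (auto intro: add_increasing2)
        qed (use a_le_\<Phi>[of p r q] that \<Phi>_nonneg ap_nonneg in auto)
        then have "(\<Sum>r\<in>{p..<q}. a r * ap ?f (z r)) \<le> (\<Sum>r\<in>{p..<q}. \<Phi> p q * ((if r = r0 then 2 else 0) + 4 / real N))"
          by (rule sum_mono)
        also have "\<dots> = \<Phi> p q * ((\<Sum>r\<in>{p..<q}. if r = r0 then 2 else 0) + real (q - p) * (4 / real N))"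
          by (simp add: sum.distrib flip: sum_distrib_left)
        also have "\<dots> \<le> \<Phi> p q * (2 + 4)"
        proof (intro mult_left_mono add_mono)
          show "(\<Sum>r\<in>{p..<q}. if r = r0 then 2 else 0) \<le> (2::real)" by (simp add: sum.delta)
          have "real (q - p) \<le> real N" using q by simp
          then show "real (q - p) * (4 / real N) \<le> 4" using N_pos by (simp add: field_simps)
        qed (rule \<Phi>_nonneg)
        also have "\<dots> = 6 * \<Phi> p q" by simp
        finally show ?thesis using X_le[of ?f p q] \<Phi>_nonneg[of p q] by linarith
      qed
    qed
  qed
  then show ?thesis using q by (simp add: X_def)
qed

text \<open>The vector \<open>y k\<close> sums \<open>n_seq (2 * k + 2)\<close> blocks of norm at
  least \<open>c k\<close>, so one even operation gives exactly the lower bound 1. The upper bound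
  is \<open>8 * 17\<close>, from \<open>ris_sum_interval_le\<close> and
  \<open>\<Phi>_total\<close>.\<close>

lemma exists_disjoint_bounded_sum:
  assumes u: "blocks u" and l: "1 \<le> l"
  obtains y :: "nat \<Rightarrow> 'a" where
    "\<And>k. k < l \<Longrightarrow> y k \<in> span (range u) \<and> 1 \<le> norm (y k)"
    "\<And>k k'. k < k' \<Longrightarrow> k' < l \<Longrightarrow> sep (\<noteq>) (y k) (y k')"
    "norm (\<Sum>k<l. y k) \<le> 136"
proof -
  interpret interlacing l using l by unfold_locales
  obtain i0 z where z: "ris N i0 z" "\<And>r. z r \<in> span (range u)"
    using exists_ris[OF u N_pos] by metis
  have sep_z: "sep (<) (z r) (z r')" if "r < r'" for r r' using z(1) that by (simp add: ris_def)
  define y where "y k = (\<Sum>r\<in>A k. c k *\<^sub>R z r)" for k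
  have "y k \<in> span (range u) \<and> 1 \<le> norm (y k)" if k: "k < l" for k
  proof
    show "y k \<in> span (range u)"
      unfolding y_def using z(2) by (intro span_sum span_scale)
    let ?n = "n_nat (2 * k + 2)"
    have "y k = (\<Sum>t<?n. c k *\<^sub>R z (t * step k + k))"
      unfolding y_def A_def by (subst sum.reindex[OF inj_A[OF k]]) simp
    moreover have "real ?n * c k / real (m_seq (2 * (k + 1))) \<le> norm (\<Sum>t<?n. c k *\<^sub>R z (t * step k + k))"
    proof (rule lower_estimate)
      show "0 < c k" by (rule c_pos)
      show "finite (cs (c k *\<^sub>R z (t * step k + k))) \<and> c k \<le> norm (c k *\<^sub>R z (t * step k + k))" for t
        using z(1) c_pos[of k] finite_subset[OF cs_scale] by (auto simp: ris_def mult_le_cancel_left1)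
      show "sep (<) (c k *\<^sub>R z (s * step k + k)) (c k *\<^sub>R z (t * step k + k))" if "s < t" for s t
        using that step_ge[OF k] l by (intro sep_scale sep_z) simp
    qed (use real_n_nat in auto)
    moreover have "real ?n * c k / real (m_seq (2 * (k + 1))) = 1"
      using n_nat_pos[of "2 * k + 2"] m_seq_pos[of "2 * k + 2"] by (simp add: c_def flip: real_n_nat)
    ultimately show "1 \<le> norm (y k)" by (simp only:)
  qed
  moreover
  have cs_y: "cs (y k) \<subseteq> (\<Union>r\<in>A k. cs (z r))" for k
    unfolding y_def by (rule order_trans[OF cs_sum UN_mono]) (auto intro: cs_scale[THEN subsetD])
  have "sep (\<noteq>) (y k) (y k')" if "k < k'" "k' < l" for k k'
    unfolding sep_def
  proof (intro ballI)
    fix i j assume "i \<in> cs (y k)" "j \<in> cs (y k')"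
    then obtain r r' where r: "r \<in> A k" "i \<in> cs (z r)" "r' \<in> A k'" "j \<in> cs (z r')"
      using cs_y by blast
    then have "r \<noteq> r'" using A_disjoint[of k k'] that by auto
    then show "i \<noteq> j"
      using sepD[OF sep_z[of r r'] r(2,4)] sepD[OF sep_z[of r' r] r(4,2)] by (cases "r < r'") auto
  qed
  moreover have "norm (\<Sum>k<l. y k) \<le> 136"
  proof (rule norm_leI)
    fix f assume f: "W f"
    have "(\<Sum>k<l. y k) = (\<Sum>k<l. \<Sum>r<N. (if r \<in> A k then c k else 0) *\<^sub>R z r)"
    proof (rule sum.cong)
      fix k assume "k \<in> {..<l}"
      then have "A k \<subseteq> {..<N}" using A_less_N by auto
      then show "y k = (\<Sum>r<N. (if r \<in> A k then c k else 0) *\<^sub>R z r)"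
        unfolding y_def by (intro sum.mono_neutral_cong_left) auto
    qed simp
    also have "\<dots> = (\<Sum>r\<in>{0..<N}. a r *\<^sub>R z r)"
      by (subst sum.swap) (simp add: a_def scaleR_sum_left lessThan_atLeast0)
    finally show "ap f (\<Sum>k<l. y k) \<le> 136"
      using ris_sum_interval_le[OF z(1) l f, of N 0] \<Phi>_total by simp
  qed
  ultimately show thesis by (rule that)
qed

end

subsection \<open>Cubes in subspaces\<close>

text \<open>The kernel has codimension at most one. Iterated, this allows finitely many coordinates
  to be annihilated in an infinite dimensional subspace.\<close>

lemma finite_dim_kernel:
  fixes \<phi> :: "'a::real_vector \<Rightarrow> real"
  assumes Y: "subspace Y" and \<phi>: "linear \<phi>" and fin: "finite_dim {w \<in> Y. \<phi> w = 0}"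
  shows "finite_dim Y"
proof (cases "\<forall>w\<in>Y. \<phi> w = 0")
  case True
  then have "{w \<in> Y. \<phi> w = 0} = Y" by blast
  then show ?thesis using fin by simp
next
  case False
  then obtain v where v: "v \<in> Y" "\<phi> v \<noteq> 0" by blast
  obtain B where B: "finite B" "{w \<in> Y. \<phi> w = 0} = span B" using fin by (auto simp: finite_dim_def)
  have "B \<subseteq> Y" using B(2) span_superset[of B] by auto
  then have "span (insert v B) \<subseteq> Y" using v(1) Y by (intro span_minimal) auto
  moreover have "w \<in> span (insert v B)" if "w \<in> Y" for w
  proof -
    let ?w = "w - (\<phi> w / \<phi> v) *\<^sub>R v"
    have "\<phi> ?w = 0" using v(2) \<phi> by (simp add: linear_diff linear_scale)
    moreover have "?w \<in> Y" using that v(1) Y by (simp add: subspace_diff subspace_scale)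
    ultimately have "?w \<in> span B" using B(2) by blast
    then show ?thesis using span_breakdown_eq[of w v B] by blast
  qed
  ultimately show ?thesis using B(1) unfolding finite_dim_def by (intro exI[of _ "insert v B"]) auto
qed

text \<open>Adding one vector at a time, the set is a sum of a compact segment and a compact set. It
  serves to show that unit spheres of finite dimensional subspaces are compact.\<close>

lemma compact_bounded_combinations:
  fixes B :: "'a::real_normed_vector set"
  assumes "finite B"
  shows "compact {x. \<exists>c. (\<forall>b\<in>B. \<bar>c b\<bar> \<le> C) \<and> x = (\<Sum>b\<in>B. c b *\<^sub>R b)}"
  using assms
proof (induction B)
  case (insert b B)
  let ?K = "\<lambda>B. {x. \<exists>c. (\<forall>b\<in>B. \<bar>c b\<bar> \<le> C) \<and> x = (\<Sum>b\<in>B. c b *\<^sub>R b)}"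
  have "compact ((\<lambda>t. t *\<^sub>R b) ` {-C..C})" by (intro compact_continuous_image continuous_intros) auto
  then have "compact {x + y |x y. x \<in> (\<lambda>t. t *\<^sub>R b) ` {-C..C} \<and> y \<in> ?K B}"
    using insert.IH by (rule compact_sums)
  also have "{x + y |x y. x \<in> (\<lambda>t. t *\<^sub>R b) ` {-C..C} \<and> y \<in> ?K B} = ?K (insert b B)"
  proof (intro equalityI subsetI)
    fix x assume "x \<in> {x + y |x y. x \<in> (\<lambda>t. t *\<^sub>R b) ` {-C..C} \<and> y \<in> ?K B}"
    then obtain t c where tc: "t \<in> {-C..C}" "\<forall>b\<in>B. \<bar>c b\<bar> \<le> C" "x = t *\<^sub>R b + (\<Sum>b\<in>B. c b *\<^sub>R b)" by auto
    have "(\<Sum>b'\<in>B. (c(b := t)) b' *\<^sub>R b') = (\<Sum>b\<in>B. c b *\<^sub>R b)"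
      using insert.hyps by (intro sum.cong) auto
    then show "x \<in> ?K (insert b B)"
      using tc insert.hyps by (intro CollectI exI[of _ "c(b := t)"]) auto
  next
    fix x assume "x \<in> ?K (insert b B)"
    then obtain c where "\<forall>b\<in>insert b B. \<bar>c b\<bar> \<le> C" "x = (\<Sum>b\<in>insert b B. c b *\<^sub>R b)" by blast
    then show "x \<in> {x + y |x y. x \<in> (\<lambda>t. t *\<^sub>R b) ` {-C..C} \<and> y \<in> ?K B}"
      using insert.hyps by (intro CollectI exI[of _ "c b *\<^sub>R b"] exI[of _ "\<Sum>b\<in>B. c b *\<^sub>R b"]) (auto simp: abs_le_iff)
  qed
  finally show ?case .
qed simp

context X4_completion
begin

lemma coord_disjoint_sum:
  fixes v :: "nat \<Rightarrow> 'a"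
  assumes disj: "\<And>s t. s < t \<Longrightarrow> t < n \<Longrightarrow> sep (\<noteq>) (v s) (v t)" and t: "t < n" "i \<in> cs (v t)"
  shows "coord i (\<Sum>s<n. b s *\<^sub>R v s) = b t * coord i (v t)"
proof -
  have "coord i (v s) = 0" if "s < n" "s \<noteq> t" for s
  proof (rule ccontr)
    assume "coord i (v s) \<noteq> 0"
    then have "i \<in> cs (v s)" by (simp add: cs_def)
    then show False
      using sepD[OF disj[of s t], of i i] sepD[OF disj[of t s], of i i] t that by (cases "s < t") auto
  qed
  then show ?thesis
    using t(1) by (simp add: coord.sum coord.scaleR) (subst sum.remove[of _ t], auto)
qed

lemma disjoint_sum_lower:
  fixes v :: "nat \<Rightarrow> 'a"
  assumes disj: "\<And>s t. s < t \<Longrightarrow> t < n \<Longrightarrow> sep (\<noteq>) (v s) (v t)" and t: "t < n" "1 \<le> norm (v t)"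
  shows "\<bar>b t\<bar> \<le> norm (\<Sum>s<n. b s *\<^sub>R v s)"
proof -
  have "\<bar>b t\<bar> * 1 \<le> \<bar>b t\<bar> * norm (v t)" using t(2) by (intro mult_left_mono) auto
  also have "\<dots> = norm (b t *\<^sub>R v t)" by simp
  also have "\<dots> \<le> norm (\<Sum>s<n. b s *\<^sub>R v s)"
  proof (rule unconditional)
    fix i
    show "\<bar>coord i (b t *\<^sub>R v t)\<bar> \<le> \<bar>coord i (\<Sum>s<n. b s *\<^sub>R v s)\<bar>"
      using coord_disjoint_sum[where v = v and n = n, OF disj t(1), where i = i and b = b]
      by (cases "i \<in> cs (v t)") (auto simp: coord.scaleR cs_def)
  qed
  finally show ?thesis by simp
qed

text \<open>The sum is dominated coordinatewise by \<open>B\<close> times the sum with all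
  coefficients 1. Together with \<open>disjoint_sum_lower\<close>, a bound on that one norm compares
  the span of \<open>v\<close> with \<open>l\<^sub>\<infinity>\<^sup>n\<close>.\<close>

lemma disjoint_sum_upper:
  fixes v :: "nat \<Rightarrow> 'a"
  assumes disj: "\<And>s t. s < t \<Longrightarrow> t < n \<Longrightarrow> sep (\<noteq>) (v s) (v t)" and b: "\<And>t. t < n \<Longrightarrow> \<bar>b t\<bar> \<le> B" "0 \<le> B"
  shows "norm (\<Sum>s<n. b s *\<^sub>R v s) \<le> B * norm (\<Sum>s<n. v s)"
proof -
  have "norm (\<Sum>s<n. b s *\<^sub>R v s) \<le> norm (B *\<^sub>R (\<Sum>s<n. v s))"
  proof (rule unconditional)
    fix i
    show "\<bar>coord i (\<Sum>s<n. b s *\<^sub>R v s)\<bar> \<le> \<bar>coord i (B *\<^sub>R (\<Sum>s<n. v s))\<bar>"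
    proof (cases "\<exists>t<n. i \<in> cs (v t)")
      case True
      then obtain t where t: "t < n" "i \<in> cs (v t)" by blast
      have "coord i (\<Sum>s<n. v s) = coord i (v t)"
        using coord_disjoint_sum[where v = v and n = n, OF disj t, where b = "\<lambda>_. 1"] by simp
      moreover have "coord i (\<Sum>s<n. b s *\<^sub>R v s) = b t * coord i (v t)"
        by (rule coord_disjoint_sum[where v = v and n = n, OF disj t])
      ultimately show ?thesis
        using b t by (simp add: coord.scaleR abs_mult mult_right_mono)
    next
      case False
      then have "coord i (\<Sum>s<n. b s *\<^sub>R v s) = 0"
        by (simp add: coord.sum coord.scaleR cs_def)
      then show ?thesis by simp
    qed
  qed
  then show ?thesis using b(2) by simp
qed

text \<open>Otherwise disjoint \<open>n\<close>-tuples of vectors of norm at least 1 always have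
  sums of norm at least \<open>1 + \<delta>\<close>. By \<open>grouping\<close> the bound becomes
  \<open>(1 + \<delta>) ^ k\<close> for \<open>n ^ k\<close> vectors and exceeds 136 for large
  \<open>k\<close>.\<close>

lemma exists_almost_isometric_cube:
  assumes u: "blocks u" and n: "1 \<le> n" and \<delta>: "0 < \<delta>"
  obtains v :: "nat \<Rightarrow> 'a" where
    "\<And>t. t < n \<Longrightarrow> v t \<in> span (range u) \<and> 1 \<le> norm (v t)"
    "\<And>s t. s < t \<Longrightarrow> t < n \<Longrightarrow> sep (\<noteq>) (v s) (v t)"
    "norm (\<Sum>t<n. v t) \<le> 1 + \<delta>"
proof (rule ccontr)
  note witness = that
  assume neg: "\<not> thesis"
  obtain k where k: "136 < (1 + \<delta>) ^ k" using real_arch_pow[of "1 + \<delta>" 136] \<delta> by auto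
  have "1 \<le> n ^ k" using n by simp
  then obtain y :: "nat \<Rightarrow> 'a" where y:
    "\<And>k'. k' < n ^ k \<Longrightarrow> y k' \<in> span (range u) \<and> 1 \<le> norm (y k')"
    "\<And>k1 k2. k1 < k2 \<Longrightarrow> k2 < n ^ k \<Longrightarrow> sep (\<noteq>) (y k1) (y k2)"
    "norm (\<Sum>k'<n ^ k. y k') \<le> 136"
    using exists_disjoint_bounded_sum[OF u] by metis
  have "(1 + \<delta>) ^ k \<le> norm (\<Sum>t<n ^ k. y t)"
  proof (rule grouping[where P = "\<lambda>\<rho> v. \<rho> \<le> norm v" and V = "span (range u)" and R = "(\<noteq>)"])
    show "c * \<rho> \<le> norm (c *\<^sub>R v)" if "0 < c" "\<rho> \<le> norm v" for c \<rho> and v :: 'a using that by simp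
    show "1 + \<delta> \<le> norm (\<Sum>t<n. x t)"
      if "\<And>t. t < n \<Longrightarrow> x t \<in> span (range u) \<and> 1 \<le> norm (x t)"
        "\<And>s t. s < t \<Longrightarrow> t < n \<Longrightarrow> sep (\<noteq>) (x s) (x t)" for x
    proof (rule ccontr)
      assume "\<not> 1 + \<delta> \<le> norm (\<Sum>t<n. x t)"
      then have thesis using that by (intro witness[of x]) auto
      with neg show False by blast
    qed
  qed (use y \<delta> in auto)
  then show False using k y(3) by linarith
qed

section \<open>The gliding hump\<close>

lemma exists_vanishing:
  assumes "subspace Y" "\<not> finite_dim Y"
  obtains w where "w \<in> Y" "norm w = 1" "\<And>n. n \<le> K \<Longrightarrow> coord n w = 0"
proof -
  define V where "V K = {w \<in> Y. \<forall>n<K. coord n w = 0}" for K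
  have V: "subspace (V K)" for K
    using assms(1) by (auto simp: V_def subspace_def coord.add coord.scaleR coord.zero)
  have "\<not> finite_dim (V K)" for K
  proof (induction K)
    case (Suc K)
    have "V (Suc K) = {w \<in> V K. coord K w = 0}" by (auto simp: V_def less_Suc_eq)
    then show ?case
      using finite_dim_kernel[OF V[of K] bounded_linear.linear[OF bounded_linear_coord[of K]]] Suc.IH by auto
  qed (use assms in \<open>simp add: V_def\<close>)
  moreover have "finite_dim {0}" unfolding finite_dim_def by (intro exI[of _ "{}"]) simp
  ultimately have "V (Suc K) \<noteq> {0}" by metis
  moreover have "0 \<in> V (Suc K)" using V by (rule subspace_0)
  ultimately obtain w where w: "w \<in> V (Suc K)" "w \<noteq> 0" by auto
  then have "(1 / norm w) *\<^sub>R w \<in> V (Suc K)" using V subspace_scale by blast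
  then show thesis using w(2) by (intro that[of "(1 / norm w) *\<^sub>R w"]) (auto simp: V_def less_Suc_eq_le)
qed

text \<open>Approximate by a finitely supported \<open>x\<close> a unit vector of \<open>Y\<close>
  that vanishes up to \<open>K\<close>. The head of \<open>x\<close> is then dominated by the
  approximation error, so the normalized tail is the required hump.\<close>

lemma exists_hump:
  assumes Y: "subspace Y" "\<not> finite_dim Y" and \<eta>: "0 < \<eta>"
  obtains u w where "w \<in> Y" "finite (cs u)" "cs u \<subseteq> {K<..}" "norm u = 1" "norm (u - w) \<le> \<eta>"
proof -
  obtain w where w: "w \<in> Y" "norm w = 1" "\<And>n. n \<le> K \<Longrightarrow> coord n w = 0"
    using exists_vanishing[OF Y, of K] by metis
  \<comment> \<open>The tail is within \<open>2 * e\<close> of \<open>w\<close> and has norm at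
    least \<open>1 / 2\<close>; dividing by that norm leaves an error of at most
    \<open>4 * e\<close>.\<close>
  define e where "e = min (\<eta> / 4) (1 / 4)"
  have e: "0 < e" "e \<le> \<eta> / 4" "e \<le> 1 / 4" using \<eta> by (auto simp: e_def)
  obtain x where x: "x \<in> c00" "norm (\<iota> x - w) < e" using iota_approx[OF e(1)] by blast
  let ?h = "restr {..K} x" and ?t = "restr {K<..} x"
  have "supp ?h \<subseteq> supp x" "supp ?t \<subseteq> supp x" by (auto simp: supp_def restr_def)
  then have c00: "?h \<in> c00" "?t \<in> c00" using x(1) finite_subset unfolding c00_def by blast+
  have "(\<lambda>i. 1 * ?h i + 1 * ?t i) = x" by (auto simp: restr_def)
  then have split: "\<iota> x = \<iota> ?h + \<iota> ?t" using iota_lincomb[OF c00, of 1 1] by simp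
  have "norm (\<iota> ?h) \<le> norm (\<iota> x - w)"
  proof (rule unconditional)
    fix n
    show "\<bar>coord n (\<iota> ?h)\<bar> \<le> \<bar>coord n (\<iota> x - w)\<bar>"
      using w(3)[of n] by (cases "n \<le> K") (simp_all add: coord_iota c00 x(1) coord.diff, simp_all add: restr_def)
  qed
  moreover have "norm (\<iota> ?t - w) \<le> norm (\<iota> x - w) + norm (\<iota> ?h)"
    using norm_triangle_ineq4[of "\<iota> x - w" "\<iota> ?h"] by (simp add: split algebra_simps)
  ultimately have d: "norm (\<iota> ?t - w) \<le> 2 * e" using x(2) by linarith
  let ?c = "norm (\<iota> ?t)"
  have "norm w \<le> ?c + norm (\<iota> ?t - w)" by norm
  then have c: "1 / 2 \<le> ?c" using d e(3) w(2) by linarith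
  show thesis
  proof
    show "(1 / ?c) *\<^sub>R w \<in> Y" using w(1) Y(1) by (simp add: subspace_scale)
    have "cs (\<iota> ?t) = supp ?t" by (simp add: cs_def supp_def coord_iota c00)
    then have sub: "cs ((1 / ?c) *\<^sub>R \<iota> ?t) \<subseteq> supp ?t" using cs_scale[of "1 / ?c" "\<iota> ?t"] by simp
    then show "finite (cs ((1 / ?c) *\<^sub>R \<iota> ?t))" using c00(2) finite_subset by (auto simp: c00_def)
    show "cs ((1 / ?c) *\<^sub>R \<iota> ?t) \<subseteq> {K<..}"
      using sub by (rule order_trans) (auto simp: supp_def restr_def split: if_splits)
    show "norm ((1 / ?c) *\<^sub>R \<iota> ?t) = 1"
    proof -
      have "?c \<noteq> 0" using c by linarith
      then show ?thesis by simp
    qed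
    have "norm ((1 / ?c) *\<^sub>R \<iota> ?t - (1 / ?c) *\<^sub>R w) = norm (\<iota> ?t - w) / ?c"
      unfolding scaleR_diff_right[symmetric] by simp
    also have "\<dots> \<le> 2 * e / (1 / 2)" using d c e(1) by (intro frac_le) auto
    also have "\<dots> \<le> \<eta>" using e(2) by simp
    finally show "norm ((1 / ?c) *\<^sub>R \<iota> ?t - (1 / ?c) *\<^sub>R w) \<le> \<eta>" .
  qed
qed

lemma exists_almost_contained_blocks:
  assumes Y: "subspace Y" "\<not> finite_dim Y" and \<eta>: "0 < \<eta>"
  obtains u w where "blocks u" "\<And>t. w t \<in> Y \<and> norm (u t - w t) \<le> \<eta> / 2 ^ Suc t"
proof -
  define P where "P t = (\<lambda>(u, w, K). w \<in> Y \<and> finite (cs u) \<and> cs u \<subseteq> {K<..} \<and> norm u = 1 \<and>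
    norm (u - w) \<le> \<eta> / 2 ^ Suc t)" for t
  define Q where "Q = (\<lambda>(u, w :: 'a, K) (u' :: 'a, w' :: 'a, K'). (K :: nat) \<le> K' \<and> cs u \<subseteq> {..K'})"
  have ex: "\<exists>u w. P t (u, w, K)" for t K
  proof -
    have "0 < \<eta> / 2 ^ Suc t" using \<eta> by simp
    then obtain u w where "w \<in> Y" "finite (cs u)" "cs u \<subseteq> {K<..}" "norm u = 1" "norm (u - w) \<le> \<eta> / 2 ^ Suc t"
      by (rule exists_hump[OF Y])
    then show ?thesis by (auto simp: P_def)
  qed
  have "\<exists>f. \<forall>t. P t (f t) \<and> Q (f t) (f (Suc t))"
  proof (rule dependent_nat_choice)
    show "\<exists>x. P 0 x" using ex by blast
  next
    fix x t assume "P t x"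
    obtain u w K where x: "x = (u, w, K)" by (cases x)
    define K' where "K' = max K (Max (cs u))"
    obtain u' w' where "P (Suc t) (u', w', K')" using ex by blast
    moreover have "Q x (u', w', K')"
      using \<open>P t x\<close> by (auto simp: x P_def Q_def K'_def le_max_iff_disj)
    ultimately show "\<exists>y. P (Suc t) y \<and> Q x y" by blast
  qed
  then obtain F where F: "\<And>t. P t (F t)" "\<And>t. Q (F t) (F (Suc t))" by blast
  define u w K where "u = (\<lambda>t. fst (F t))" and "w = (\<lambda>t. fst (snd (F t)))" and "K = (\<lambda>t. snd (snd (F t)))"
  have F_eq: "F t = (u t, w t, K t)" for t by (simp add: u_def w_def K_def)
  have u: "w t \<in> Y" "finite (cs (u t))" "cs (u t) \<subseteq> {K t<..}" "norm (u t) = 1" "norm (u t - w t) \<le> \<eta> / 2 ^ Suc t" for t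
    using F(1)[of t] by (simp_all add: F_eq P_def)
  have Q: "K t \<le> K (Suc t)" "cs (u t) \<subseteq> {..K (Suc t)}" for t
    using F(2)[of t] by (simp_all add: F_eq Q_def)
  have K_mono: "K s \<le> K t" if "s \<le> t" for s t
    using Q(1) that by (rule lift_Suc_mono_le)
  have "sep (<) (u s) (u t)" if "s < t" for s t
    unfolding sep_def
  proof (intro ballI)
    fix n n' assume "n \<in> cs (u s)" "n' \<in> cs (u t)"
    then have "n \<le> K (Suc s)" "K t < n'" using Q(2)[of s] u(3)[of t] by auto
    moreover have "K (Suc s) \<le> K t" using that by (intro K_mono) simp
    ultimately show "n < n'" by linarith
  qed
  then have "blocks u" using u by (simp add: blocks_def)
  then show thesis using u by (intro that) auto
qed

lemma span_range_lessThan: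
  fixes u :: "nat \<Rightarrow> 'a"
  assumes "v \<in> span (range u)"
  obtains c T where "v = (\<Sum>t<(T::nat). c t *\<^sub>R u t)"
proof -
  from assms have "\<exists>c T. v = (\<Sum>t<(T::nat). c t *\<^sub>R u t)"
  proof (induction rule: span_induct_alt)
    case base
    show ?case by (intro exI[of _ "\<lambda>_. 0"] exI[of _ 0]) simp
  next
    case (step a x y)
    then obtain s c T where s: "x = u s" and y: "y = (\<Sum>t<(T::nat). c t *\<^sub>R u t)" by blast
    let ?T = "max T (Suc s)" and ?c = "\<lambda>t. (if t < T then c t else 0) + (if t = s then a else 0)"
    have "(\<Sum>t<?T. (if t < T then c t else 0) *\<^sub>R u t) = y"
      unfolding y by (intro sum.mono_neutral_cong_right) auto
    moreover have "(\<Sum>t<?T. (if t = s then a else 0) *\<^sub>R u t) = a *\<^sub>R x"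
    proof -
      have "(\<Sum>t<?T. (if t = s then a else 0) *\<^sub>R u t) = (\<Sum>t<?T. if t = s then a *\<^sub>R u t else 0)"
        by (intro sum.cong) auto
      then show ?thesis by (simp add: s less_max_iff_disj)
    qed
    ultimately have "a *\<^sub>R x + y = (\<Sum>t<?T. ?c t *\<^sub>R u t)"
      by (simp add: scaleR_add_left sum.distrib)
    then show ?case by (intro exI[of _ ?c] exI[of _ ?T])
  qed
  then show thesis using that by blast
qed

text \<open>Unconditionality bounds every coefficient of \<open>v\<close> by \<open>norm v\<close>,
  so replacing each \<open>u t\<close> by \<open>w t\<close> costs at most a geometric series times
  \<open>norm v\<close>.\<close>

lemma approx_in_subspace:
  assumes Y: "subspace Y" and u: "blocks u"
    and w: "\<And>t. w t \<in> Y \<and> norm (u t - w t) \<le> \<eta> / 2 ^ Suc t"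
    and v: "v \<in> span (range u)"
  obtains v' where "v' \<in> Y" "norm (v - v') \<le> \<eta> * norm v"
proof -
  obtain c T where c: "v = (\<Sum>t<(T::nat). c t *\<^sub>R u t)" using v by (rule span_range_lessThan)
  have sep: "sep (\<noteq>) (u s) (u t)" if "s < t" for s t
    using u that by (fastforce simp: blocks_def sep_def)
  have "0 \<le> \<eta> / 2 ^ Suc 0" using w[of 0] norm_ge_zero order_trans by blast
  then have \<eta>: "0 \<le> \<eta>" by simp
  have le: "norm (c t *\<^sub>R (u t - w t)) \<le> norm v * \<eta> * (1 / 2) ^ Suc t" if "t < T" for t
  proof -
    have "\<bar>c t\<bar> \<le> norm v" unfolding c using that u sep by (intro disjoint_sum_lower) (auto simp: blocks_def)
    then have "\<bar>c t\<bar> * norm (u t - w t) \<le> norm v * (\<eta> / 2 ^ Suc t)" using w by (intro mult_mono) auto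
    then show ?thesis by (simp add: power_divide)
  qed
  have "norm (v - (\<Sum>t<T. c t *\<^sub>R w t)) = norm (\<Sum>t<T. c t *\<^sub>R (u t - w t))"
    by (simp add: c scaleR_diff_right sum_subtractf)
  also have "\<dots> \<le> (\<Sum>t<T. norm v * \<eta> * (1 / 2) ^ Suc t)"
    using le by (intro norm_sum[THEN order_trans] sum_mono) auto
  also have "\<dots> = norm v * \<eta> * (\<Sum>t<T. (1 / 2) ^ Suc t)" by (simp add: sum_distrib_left)
  also have "(\<Sum>t<j. (1 / 2 :: real) ^ Suc t) = 1 - (1 / 2) ^ j" for j by (induction j) auto
  also have "norm v * \<eta> * (1 - (1 / 2) ^ T) \<le> norm v * \<eta> * 1" using \<eta> by (intro mult_left_mono) auto
  finally have "norm (v - (\<Sum>t<T. c t *\<^sub>R w t)) \<le> \<eta> * norm v" by (simp add: mult.commute)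
  moreover have "(\<Sum>t<T. c t *\<^sub>R w t) \<in> Y" using w Y by (intro subspace_sum subspace_scale) auto
  ultimately show thesis using that by blast
qed

section \<open>Embedding finite dimensional subspaces\<close>

text \<open>Biorthogonal functionals are built one basis vector at a time out of coordinate
  functionals, which separate points.\<close>

lemma exists_dual_system:
  fixes B :: "'a set"
  assumes "finite B" "independent B"
  shows "\<exists>g :: 'a \<Rightarrow> 'a \<Rightarrow> real. (\<forall>b\<in>B. bounded_linear (g b)) \<and> (\<forall>b\<in>B. \<forall>b'\<in>B. g b b' = (if b = b' then 1 else 0))"
  using assms
proof (induction B)
  case (insert b B)
  then have ind: "independent B" "b \<notin> span B" by (simp_all add: independent_insert)
  obtain g :: "'a \<Rightarrow> 'a \<Rightarrow> real" where g: "\<And>c. c \<in> B \<Longrightarrow> bounded_linear (g c)"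
      "\<And>c c'. c \<in> B \<Longrightarrow> c' \<in> B \<Longrightarrow> g c c' = (if c = c' then 1 else 0)"
    using insert.IH[OF ind(1)] by blast
  define v where "v = b - (\<Sum>c\<in>B. g c b *\<^sub>R c)"
  have "(\<Sum>c\<in>B. g c b *\<^sub>R c) \<in> span B" by (intro span_sum span_scale span_base)
  then have "v \<noteq> 0" using ind(2) by (auto simp: v_def)
  then obtain n where n: "coord n v \<noteq> 0" using cs_eq_empty[of v] by (auto simp: cs_def)
  \<comment> \<open>\<open>G\<close> is a coordinate composed with the projection
    \<open>x - (\<Sum>c\<in>B. g c x *\<^sub>R c)\<close>, scaled to be 1 at \<open>b\<close>; it
    vanishes on \<open>B\<close>. The old functionals are then corrected by multiples of
    \<open>G\<close> to vanish at \<open>b\<close>.\<close>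
  define G where "G x = (coord n x - (\<Sum>c\<in>B. coord n c * g c x)) * (1 / coord n v)" for x
  have G: "bounded_linear G"
    unfolding G_def
    by (intro bounded_linear_mult_const bounded_linear_sub bounded_linear_sum bounded_linear_const_mult
        bounded_linear_coord g(1))
  have "coord n v = coord n b - (\<Sum>c\<in>B. coord n c * g c b)"
    by (simp add: v_def coord.diff coord.sum coord.scaleR mult.commute)
  then have Gb: "G b = 1" using n by (simp add: G_def)
  have Gc: "G c = 0" if "c \<in> B" for c
  proof -
    have "(\<Sum>c'\<in>B. coord n c' * g c' c) = (\<Sum>c'\<in>B. if c' = c then coord n c' else 0)"
      using that g(2) by (intro sum.cong) auto
    then show ?thesis using that insert.hyps by (simp add: G_def)
  qed
  let ?g = "\<lambda>c x. if c = b then G x else g c x - g c b * G x"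
  have "bounded_linear (?g c)" if "c \<in> insert b B" for c
    using that G g(1)[of c] by (cases "c = b") (auto intro!: bounded_linear_sub bounded_linear_const_mult)
  moreover have "?g c c' = (if c = c' then 1 else 0)" if "c \<in> insert b B" "c' \<in> insert b B" for c c'
    using that g(2) Gb Gc insert.hyps by auto
  ultimately show ?case by (intro exI[of _ ?g]) blast
qed simp

text \<open>Each unit vector of \<open>E\<close> lies in an open set on which one functional exceeds
  \<open>1 - \<theta>\<close>; finitely many of these cover the compact unit sphere.\<close>

lemma finite_dim_norming_set:
  fixes E :: "'a set"
  assumes E: "subspace E" "finite_dim E" and \<theta>: "0 < \<theta>"
  obtains F where "finite F" "\<And>f. f \<in> F \<Longrightarrow> W f" "\<And>e. e \<in> E \<Longrightarrow> \<exists>f\<in>insert (unit_vec 1) F. (1 - \<theta>) * norm e \<le> \<bar>pr f e\<bar>"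
proof -
  obtain B0 where B0: "finite B0" "E = span B0" using E(2) by (auto simp: finite_dim_def)
  obtain B where B: "B \<subseteq> B0" "independent B" "B0 \<subseteq> span B" using maximal_independent_subset[of B0] by blast
  have finB: "finite B" using B(1) B0(1) by (rule finite_subset)
  have EB: "E = span B"
    using B B0(2) span_mono[of B B0] span_minimal[OF B(3) subspace_span] by auto
  obtain g :: "'a \<Rightarrow> 'a \<Rightarrow> real" where g: "\<And>c. c \<in> B \<Longrightarrow> bounded_linear (g c)"
      "\<And>c c'. c \<in> B \<Longrightarrow> c' \<in> B \<Longrightarrow> g c c' = (if c = c' then 1 else 0)"
    using exists_dual_system[OF finB B(2)] by blast
  define p where "p x = (\<Sum>b\<in>B. g b x *\<^sub>R b)" for x
  have p: "bounded_linear p"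
    unfolding p_def by (intro bounded_linear_sum bounded_linear_scaleR_const g(1))
  have pE: "p e = e" if "e \<in> E" for e
  proof -
    have "e \<in> span B" using that EB by simp
    then show ?thesis
    proof (induction rule: span_induct_alt)
      case base
      show ?case using p by (simp add: linear_simps)
    next
      case (step a x y)
      have "p x = (\<Sum>b\<in>B. if b = x then b else 0)"
        unfolding p_def using step.hyps g(2) by (intro sum.cong) auto
      then have "p x = x" using step.hyps finB by simp
      then show ?case using step.IH p by (simp add: linear_simps)
    qed
  qed
  have pE': "p e \<in> E" for e unfolding p_def EB by (intro span_sum span_scale span_base)
  define S where "S = {e \<in> E. norm e = 1}"
  \<comment> \<open>Describing \<open>E\<close> as the fixed point set of the continuous projection
    \<open>p\<close> shows that the sphere is closed.\<close>
  have S_eq: "S = {e. p e = e} \<inter> {e. norm e = 1}" using pE pE' by (auto simp: S_def) metis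
  have "\<forall>b\<in>B. \<exists>C. \<forall>x. \<bar>g b x\<bar> \<le> norm x * C"
    using bounded_linear.bounded[OF g(1)] by auto
  then obtain C where C: "\<And>b x. b \<in> B \<Longrightarrow> \<bar>g b x\<bar> \<le> norm x * C b" by metis
  let ?C = "\<Sum>b\<in>B. \<bar>C b\<bar>"
  let ?K = "{x. \<exists>c. (\<forall>b\<in>B. \<bar>c b\<bar> \<le> ?C) \<and> x = (\<Sum>b\<in>B. c b *\<^sub>R b)}"
  have "e \<in> ?K" if "e \<in> S" for e
  proof -
    have "\<bar>g b e\<bar> \<le> ?C" if "b \<in> B" for b
    proof -
      have "\<bar>g b e\<bar> \<le> \<bar>C b\<bar>" using C[OF that, of e] \<open>e \<in> S\<close> by (simp add: S_def)
      also have "\<dots> \<le> ?C" using that finB by (intro member_le_sum) auto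
      finally show ?thesis .
    qed
    moreover have "e = (\<Sum>b\<in>B. g b e *\<^sub>R b)" using pE[of e] that by (simp add: S_def p_def)
    ultimately show ?thesis by (intro CollectI exI[of _ "\<lambda>b. g b e"]) blast
  qed
  then have "S = ?K \<inter> S" by blast
  moreover have "closed S"
    unfolding S_eq using p
    by (intro closed_Int closed_Collect_eq continuous_intros linear_continuous_on)
  ultimately have cptS: "compact S"
    using compact_Int_closed[OF compact_bounded_combinations[OF finB, of ?C], of S] by simp
  have cover: "S \<subseteq> (\<Union>f\<in>{f. W f}. {e. 1 - \<theta> < pr f e})"
  proof
    fix e assume "e \<in> S"
    then show "e \<in> (\<Union>f\<in>{f. W f}. {e. 1 - \<theta> < pr f e})"
      using exists_norming[OF \<theta>, of e] by (auto simp: S_def)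
  qed
  have op: "open {e. 1 - \<theta> < pr f e}" for f
    by (intro open_Collect_less continuous_intros linear_continuous_on bounded_linear_pr)
  obtain F where F: "F \<subseteq> {f. W f}" "finite F" "S \<subseteq> (\<Union>f\<in>F. {e. 1 - \<theta> < pr f e})"
    by (rule compactE_image[OF cptS op cover])
  have "\<exists>f\<in>insert (unit_vec 1) F. (1 - \<theta>) * norm e \<le> \<bar>pr f e\<bar>" if "e \<in> E" for e
  \<comment> \<open>For \<open>E = {0}\<close> the sphere is empty and \<open>F\<close> may be empty
    too; \<open>unit_vec 1\<close> then provides a functional for the zero vector.\<close>
  proof (cases "e = 0")
    case False
    then have "(1 / norm e) *\<^sub>R e \<in> S" using that E(1) by (simp add: S_def subspace_scale)
    then obtain f where f: "f \<in> F" "1 - \<theta> < pr f ((1 / norm e) *\<^sub>R e)" using F(3) by blast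
    then have "(1 - \<theta>) * norm e \<le> pr f e" using False by (simp add: pr.scaleR field_simps)
    then show ?thesis using f(1) by force
  qed auto
  then show thesis using F that by blast
qed

text \<open>The values of finitely many norming functionals map \<open>E\<close> almost
  isometrically into \<open>l\<^sub>\<infinity>\<^sup>n\<close>. These values become coefficients of
  an almost isometric cube, whose vectors are finally moved into \<open>Y\<close>.\<close>

lemma finite_dim_embeds:
  fixes E Y :: "'a set"
  assumes Y: "subspace Y" "\<not> finite_dim Y" and E: "subspace E" "finite_dim E" and \<theta>: "0 < \<theta>" "\<theta> < 1"
  obtains T where "linear T" "T ` E \<subseteq> Y"
    "\<And>e. e \<in> E \<Longrightarrow> (1 - \<theta>)\<^sup>2 * norm e \<le> norm (T e) \<and> norm (T e) \<le> (1 + 2 * \<theta>) * norm e"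
proof -
  obtain F where F: "finite F" "\<And>f. f \<in> F \<Longrightarrow> W f"
    "\<And>e. e \<in> E \<Longrightarrow> \<exists>f\<in>insert (unit_vec 1) F. (1 - \<theta>) * norm e \<le> \<bar>pr f e\<bar>"
    using finite_dim_norming_set[OF E \<theta>(1)] by metis
  obtain xs where xs: "set xs = insert (unit_vec 1) F" using finite_list[of "insert (unit_vec 1) F"] F(1) by auto
  define n where "n = length xs"
  define f where "f t = xs ! t" for t
  have n: "1 \<le> n" using xs by (cases xs) (auto simp: n_def)
  have Wf: "W (f t)" if "t < n" for t
    using that xs F(2) W4_has_weight.unit[of 1 L1 L2 dec] nth_mem[of t xs] by (auto simp: n_def f_def)
  have norming: "\<exists>t<n. (1 - \<theta>) * norm e \<le> \<bar>pr (f t) e\<bar>" if e: "e \<in> E" for e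
  proof -
    obtain g where "g \<in> set xs" "(1 - \<theta>) * norm e \<le> \<bar>pr g e\<bar>" using F(3)[OF e] xs by blast
    then show ?thesis by (auto simp: in_set_conv_nth n_def f_def)
  qed
  \<comment> \<open>Each cube vector has norm at most 2 and moves by at most
    \<open>2 * \<eta>\<close>, so \<open>n\<close> of them with coefficients at most
    \<open>M\<close> move the image by at most \<open>\<theta> * M\<close>.\<close>
  define \<eta> where "\<eta> = \<theta> / (2 * real n)"
  have \<eta>: "0 < \<eta>" using \<theta> n by (simp add: \<eta>_def)
  obtain u w where u: "blocks u" "\<And>t. w t \<in> Y \<and> norm (u t - w t) \<le> \<eta> / 2 ^ Suc t"
    using exists_almost_contained_blocks[OF Y \<eta>] by metis
  obtain v :: "nat \<Rightarrow> 'a" where v: "\<And>t. t < n \<Longrightarrow> v t \<in> span (range u) \<and> 1 \<le> norm (v t)"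
    "\<And>s t. s < t \<Longrightarrow> t < n \<Longrightarrow> sep (\<noteq>) (v s) (v t)" "norm (\<Sum>t<n. v t) \<le> 1 + \<theta>"
    using exists_almost_isometric_cube[OF u(1) n \<theta>(1)] by metis
  have norm_v: "norm (v t) \<le> 2" if "t < n" for t
  proof -
    have "norm (\<Sum>s<n. (if s = t then 1 else 0) *\<^sub>R v s) \<le> 1 * norm (\<Sum>s<n. v s)"
      by (intro disjoint_sum_upper v(2)) auto
    moreover have "(\<Sum>s<n. (if s = t then 1 else 0) *\<^sub>R v s) = (\<Sum>s<n. if s = t then v s else 0)"
      by (intro sum.cong) auto
    ultimately show ?thesis using that v(3) \<theta>(2) by simp
  qed
  have "\<exists>v'. v' \<in> Y \<and> norm (v t - v') \<le> 2 * \<eta>" if t: "t < n" for t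
  proof -
    obtain v' where "v' \<in> Y" "norm (v t - v') \<le> \<eta> * norm (v t)"
      using approx_in_subspace[OF Y(1) u, of "v t"] v(1)[OF t] by metis
    moreover have "\<eta> * norm (v t) \<le> \<eta> * 2" using norm_v[OF t] \<eta> by (intro mult_left_mono) auto
    ultimately show ?thesis by (intro exI[of _ v']) auto
  qed
  then obtain v' where v': "\<And>t. t < n \<Longrightarrow> v' t \<in> Y" "\<And>t. t < n \<Longrightarrow> norm (v t - v' t) \<le> 2 * \<eta>" by metis
  define T where "T e = (\<Sum>t<n. pr (f t) e *\<^sub>R v' t)" for e
  show thesis
  proof
    show "linear T"
      unfolding T_def
      by (intro bounded_linear.linear bounded_linear_sum bounded_linear_scaleR_const bounded_linear_pr)
    show "T ` E \<subseteq> Y" unfolding T_def using v'(1) Y(1) by (auto intro!: subspace_sum subspace_scale)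
    fix e assume e: "e \<in> E"
    define M where "M = Max ((\<lambda>t. \<bar>pr (f t) e\<bar>) ` {..<n})"
    have M: "\<bar>pr (f t) e\<bar> \<le> M" if "t < n" for t using that by (simp add: M_def)
    have "M \<in> (\<lambda>t. \<bar>pr (f t) e\<bar>) ` {..<n}" unfolding M_def using n by (intro Max_in) (auto simp: lessThan_empty_iff)
    then obtain t0 where t0: "t0 < n" "M = \<bar>pr (f t0) e\<bar>" by auto
    have M_le: "M \<le> norm e" unfolding t0(2) using Wf[OF t0(1)] by (rule abs_pr_le_norm)
    have le_M: "(1 - \<theta>) * norm e \<le> M" using norming[OF e] M by (meson order_trans)
    have M0: "0 \<le> M" using t0(2) by simp
    let ?Z = "\<Sum>t<n. pr (f t) e *\<^sub>R v t"
    have "norm (T e - ?Z) = norm (\<Sum>t<n. pr (f t) e *\<^sub>R (v t - v' t))"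
      unfolding norm_minus_commute[of "T e"] by (simp add: T_def scaleR_diff_right sum_subtractf)
    also have "\<dots> \<le> (\<Sum>t<n. M * (2 * \<eta>))"
    proof (intro norm_sum[THEN order_trans] sum_mono)
      fix t assume "t \<in> {..<n}"
      then show "norm (pr (f t) e *\<^sub>R (v t - v' t)) \<le> M * (2 * \<eta>)"
        unfolding norm_scaleR using M v'(2) by (intro mult_mono) (auto intro: order_trans[OF _ M])
    qed
    also have "\<dots> = \<theta> * M" using n by (simp add: \<eta>_def)
    finally have d: "norm (T e - ?Z) \<le> \<theta> * M" .
    have "norm ?Z \<le> M * norm (\<Sum>t<n. v t)"
      using v(2) M M0 by (intro disjoint_sum_upper) auto
    also have "\<dots> \<le> M * (1 + \<theta>)" using v(3) M0 by (rule mult_left_mono)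
    finally have up: "norm ?Z \<le> M * (1 + \<theta>)" .
    have low: "M \<le> norm ?Z" unfolding t0(2) using t0(1) v by (intro disjoint_sum_lower) auto
    show "(1 - \<theta>)\<^sup>2 * norm e \<le> norm (T e) \<and> norm (T e) \<le> (1 + 2 * \<theta>) * norm e"
    proof
      have "(1 - \<theta>)\<^sup>2 * norm e = (1 - \<theta>) * ((1 - \<theta>) * norm e)" by (simp add: power2_eq_square)
      also have "\<dots> \<le> (1 - \<theta>) * M" using le_M \<theta> by (intro mult_left_mono) auto
      also have "\<dots> \<le> norm ?Z - norm (T e - ?Z)" using low d by (simp add: algebra_simps)
      also have "\<dots> \<le> norm (T e)" by norm
      finally show "(1 - \<theta>)\<^sup>2 * norm e \<le> norm (T e)" .
      have "norm (T e) \<le> norm ?Z + norm (T e - ?Z)" by norm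
      also have "\<dots> \<le> (1 + 2 * \<theta>) * M" using up d by (simp add: algebra_simps)
      also have "\<dots> \<le> (1 + 2 * \<theta>) * norm e" using M_le \<theta> by (intro mult_left_mono) auto
      finally show "norm (T e) \<le> (1 + 2 * \<theta>) * norm e" .
    qed
  qed
qed

lemma locally_minimal_UNIV: "locally_minimal (UNIV :: 'a set)"
  unfolding locally_minimal_def finitely_represented_def
proof (intro allI impI)
  fix Y E :: "'a set" and \<epsilon> :: real
  assume "subspace Y \<and> closed Y \<and> Y \<subseteq> UNIV \<and> \<not> finite_dim Y" and E: "subspace E \<and> E \<subseteq> UNIV \<and> finite_dim E"
    and \<epsilon>: "0 < \<epsilon>"
  then have Y: "subspace Y" "\<not> finite_dim Y" by auto
  \<comment> \<open>Chosen so that the distortion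
    \<open>(1 + 2 * \<theta>) / (1 - \<theta>)\<^sup>2\<close> is at most
    \<open>1 + \<epsilon>\<close>.\<close>
  define \<theta> where "\<theta> = min (1 / 4) (\<epsilon> / 8)"
  have \<theta>: "0 < \<theta>" "\<theta> \<le> 1 / 4" "\<theta> \<le> \<epsilon> / 8" using \<epsilon> by (auto simp: \<theta>_def)
  obtain T where T: "linear T" "T ` E \<subseteq> Y"
    "\<And>e. e \<in> E \<Longrightarrow> (1 - \<theta>)\<^sup>2 * norm e \<le> norm (T e) \<and> norm (T e) \<le> (1 + 2 * \<theta>) * norm e"
    using finite_dim_embeds[OF Y, of E \<theta>] E \<theta> by auto
  have pos: "0 < (1 - \<theta>)\<^sup>2" using \<theta> by simp
  have E0: "0 \<in> E" using E by (simp add: subspace_0)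
  have inj: "inj_on T E"
  proof (rule inj_onI)
    fix x y assume xy: "x \<in> E" "y \<in> E" "T x = T y"
    then have "T (x - y) = 0" "x - y \<in> E" using T(1) E by (auto simp: linear_diff subspace_diff)
    then have "(1 - \<theta>)\<^sup>2 * norm (x - y) \<le> 0" using T(3)[of "x - y"] by simp
    then show "x = y" using pos by (simp add: mult_le_0_iff)
  qed
  have "onorm_on E T \<le> 1 + 2 * \<theta>"
    unfolding onorm_on_def
  proof (rule cSUP_least)
    fix x assume "x \<in> E"
    then show "norm (T x) / norm x \<le> 1 + 2 * \<theta>"
      using T(3)[of x] \<theta>(1) by (cases "x = 0") (auto simp: field_simps)
  qed (use E0 in auto)
  moreover have inv: "norm (inv_into E T y) / norm y \<le> 1 / (1 - \<theta>)\<^sup>2" if "y \<in> T ` E" for y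
  proof -
    obtain x where x: "x \<in> E" "y = T x" using \<open>y \<in> T ` E\<close> by blast
    show ?thesis
    proof (cases "T x = 0")
      case False
      then show ?thesis
        using T(3)[OF x(1)] pos x inj by (simp add: inv_into_f_f field_simps)
    qed (simp add: x(2))
  qed
  have "onorm_on (T ` E) (inv_into E T) \<le> 1 / (1 - \<theta>)\<^sup>2"
    unfolding onorm_on_def by (rule cSUP_least) (use E0 inv in auto)
  \<comment> \<open>Needed to multiply the two bounds; the quotient at the vector
    \<open>T 0 = 0\<close> is 0 and lies below the supremum.\<close>
  moreover have "0 \<le> onorm_on (T ` E) (inv_into E T)"
  proof -
    have "norm (inv_into E T (T 0)) / norm (T 0) \<le> onorm_on (T ` E) (inv_into E T)"
      unfolding onorm_on_def
      by (rule cSUP_upper) (use E0 inv in \<open>auto intro!: bdd_aboveI2[where M = "1 / (1 - \<theta>)\<^sup>2"]\<close>)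
    then show ?thesis using T(1) by (simp add: linear_0)
  qed
  ultimately have "onorm_on E T * onorm_on (T ` E) (inv_into E T) \<le> (1 + 2 * \<theta>) * (1 / (1 - \<theta>)\<^sup>2)"
    using \<theta>(1) by (intro mult_mono) auto
  also have "\<dots> \<le> 1 + \<epsilon>"
  proof -
    have "2 * \<theta> * \<epsilon> \<le> 2 * (1 / 4) * \<epsilon>" using \<theta> \<epsilon> by (intro mult_right_mono mult_left_mono) auto
    then have "1 + 2 * \<theta> \<le> (1 + \<epsilon>) * (1 - 2 * \<theta>)" using \<theta>(3) by (simp add: algebra_simps)
    also have "\<dots> \<le> (1 + \<epsilon>) * (1 - \<theta>)\<^sup>2"
      using \<epsilon> by (intro mult_left_mono) (auto simp: power2_eq_square algebra_simps)
    finally show ?thesis using pos by (simp add: field_simps)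
  qed
  finally show "\<exists>T. linear T \<and> inj_on T E \<and> T ` E \<subseteq> Y \<and>
      onorm_on E T * onorm_on (T ` E) (inv_into E T) \<le> 1 + \<epsilon>"
    using T(1,2) inj by blast
qed

end

theorem theorem4p1:
  fixes L1 L2 :: "nat set"
    and dec :: "nat \<Rightarrow> vec list"
    and \<iota> :: "vec \<Rightarrow> 'a::banach"
  assumes partition: "L1 \<union> L2 = {1..}" "L1 \<inter> L2 = {}"
    and infinite_parts: "infinite L1" "infinite L2"
    and completion: "is_completion_of_c00 (X4_norm L1 L2 dec) \<iota>"
  shows "locally_minimal (UNIV :: 'a set)"
proof -
  interpret X4_completion L1 L2 dec \<iota> using completion by unfold_locales
  show ?thesis by (rule locally_minimal_UNIV)
qed

end
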